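(* Suppose the universe size $U = \mathrm{poly}(n)$ is a sufficiently large polynomial in $n$. If a classical open-addressed hash table stores (up to) $n$ keys with load factor $1 - \epsilon$, where $1/n \le \epsilon \le \Theta(1)$, then its expected amortized time per operation is $\Omega(\log \log \epsilon^{-1})$. Moreover, as long as its expected query time is $O\big(2^{\sqrt{\log \epsilon^{-1}}}\big)$, its expected amortized time per insertion/deletion is $\Omega(\log \log \epsilon^{-1})$.
   Context: A classical open-addressed hash table with capacity $N$ stores its key set $S \subseteq [U]$ in an array of $N$ slots, each slot holding one key or being free, each key appearing exactly once; it may store only $N$, $n$ besides the array, and may use fully random hash functions. Each key $x$ has a probe sequence $h_1(x), h_2(x), \ldots \in [N]$ determined only by $x$, $N$ and random bits; a query for $x$ examines $h_1(x), h_2(x), \ldots$ in order until $x$ is found or it can conclude that $x$ is absent. Insertions and deletions may rearrange keys arbitrarily subject to queries remaining correct. Load factor $1-\epsilon$ here means $N = (1+\Theta(\epsilon)) n$. The expected amortized time is measured on the following random workload: initialize the table with $n$ uniformly random keys from $[U]$, then repeat $n^2$ times: delete a uniformly random element of the current key set $S$, then insert a uniformly random element of $[U]\setminus S$. *)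

theory Defs
  imports "HOL-Probability.Probability"
begin

text \<open>Keys are the naturals below \<open>U\<close>, slots the naturals below \<open>N\<close>; probe sequences are
  indexed from 0.\<close>

type_synonym bits = "nat \<Rightarrow> bool"
type_synonym slots = "nat option list"

definition random_bits :: "bits measure" where
  "random_bits = PiM UNIV (\<lambda>_. measure_pmf (bernoulli_pmf (1/2)))"

datatype operation = Insert nat | Delete nat

text \<open>The code of an update is a decision tree whose nodes are accesses to the array. Its time
  is the number of these accesses, so all local computation is free.\<close>

datatype program =
    Done
  | Read nat "nat option \<Rightarrow> program"
  | Write nat "nat option" program

primrec run :: "program \<Rightarrow> slots \<Rightarrow> slots \<times> nat" where
  "run Done A = (A, 0)"
| "run (Read i p) A = apsnd Suc (run (p (A ! i)) A)"
| "run (Write i v p) A = apsnd Suc (run p (A[i := v]))"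

primrec in_range :: "nat \<Rightarrow> nat \<Rightarrow> program \<Rightarrow> bool" where
  "in_range U N Done \<longleftrightarrow> True"
| "in_range U N (Read i p) \<longleftrightarrow> i < N \<and> (\<forall>v. in_range U N (p v))"
| "in_range U N (Write i v p) \<longleftrightarrow> i < N \<and> (\<forall>x. v = Some x \<longrightarrow> x < U) \<and> in_range U N p"

text \<open>A table is considered for one fixed choice of \<open>U\<close>, \<open>N\<close> and maximal number of keys \<open>n\<close>,
  on which all components may therefore depend.
  The first argument of every component is the permanent randomness (the hash functions).
  The probe sequence of a key depends on nothing else.
  The arguments of \<open>gives_up\<close> are, further, the queried key, the current number of keys and the
  contents of the slots probed so far.
  The arguments of \<open>updater\<close> are, further, fresh random bits for this operation, the current
  number of keys and the operation. Apart from these, an update sees only the array.\<close>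

record table =
  probe :: "bits \<Rightarrow> nat \<Rightarrow> nat \<Rightarrow> nat"
  gives_up :: "bits \<Rightarrow> nat \<Rightarrow> nat \<Rightarrow> nat option list \<Rightarrow> bool"
  updater :: "bits \<Rightarrow> bits \<Rightarrow> nat \<Rightarrow> operation \<Rightarrow> program"

definition keys :: "slots \<Rightarrow> nat set" where
  "keys A = {x. Some x \<in> set A}"

definition seen :: "table \<Rightarrow> bits \<Rightarrow> slots \<Rightarrow> nat \<Rightarrow> nat \<Rightarrow> nat option list" where
  "seen T \<omega> A x i = map (\<lambda>j. A ! probe T \<omega> x j) [0..<i]"

definition query_stops :: "table \<Rightarrow> bits \<Rightarrow> slots \<Rightarrow> nat \<Rightarrow> nat \<Rightarrow> bool" where
  "query_stops T \<omega> A x i \<longleftrightarrow>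
     Some x \<in> set (seen T \<omega> A x i) \<or> gives_up T \<omega> x (card (keys A)) (seen T \<omega> A x i)"

definition query_time :: "table \<Rightarrow> bits \<Rightarrow> slots \<Rightarrow> nat \<Rightarrow> nat" where
  "query_time T \<omega> A x = (LEAST i. query_stops T \<omega> A x i)"

definition query_correct :: "table \<Rightarrow> bits \<Rightarrow> slots \<Rightarrow> nat \<Rightarrow> bool" where
  "query_correct T \<omega> A x \<longleftrightarrow>
     (\<exists>i. query_stops T \<omega> A x i) \<and>
     (Some x \<in> set (seen T \<omega> A x (query_time T \<omega> A x)) \<longleftrightarrow> x \<in> keys A)"

definition perform :: "table \<Rightarrow> bits \<Rightarrow> bits \<Rightarrow> slots \<Rightarrow> operation \<Rightarrow> slots \<times> nat" where
  "perform T \<omega> \<rho> A u = run (updater T \<omega> \<rho> (card (keys A)) u) A"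

fun applicable :: "nat \<Rightarrow> nat \<Rightarrow> nat set \<Rightarrow> operation \<Rightarrow> bool" where
  "applicable U n S (Insert x) \<longleftrightarrow> x < U \<and> x \<notin> S \<and> card S < n"
| "applicable U n S (Delete x) \<longleftrightarrow> x \<in> S"

fun apply_operation :: "operation \<Rightarrow> nat set \<Rightarrow> nat set" where
  "apply_operation (Insert x) S = insert x S"
| "apply_operation (Delete x) S = S - {x}"

inductive reachable :: "nat \<Rightarrow> nat \<Rightarrow> nat \<Rightarrow> table \<Rightarrow> bits \<Rightarrow> slots \<Rightarrow> bool"
  for U N n T \<omega> where
  empty: "reachable U N n T \<omega> (replicate N None)"
| step: "reachable U N n T \<omega> A \<Longrightarrow> applicable U n (keys A) u
    \<Longrightarrow> reachable U N n T \<omega> (fst (perform T \<omega> \<rho> A u))"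

text \<open>Correctness is required for all outcomes of the random bits. The first three assumptions
  only serve to make the expectations below meaningful.\<close>

locale classical_table =
  fixes U N n :: nat and T :: table
  assumes measurable_probe:
      "(\<lambda>\<omega>. probe T \<omega> x i) \<in> measurable random_bits (count_space UNIV)"
    and measurable_gives_up:
      "(\<lambda>\<omega>. gives_up T \<omega> x m vs) \<in> measurable random_bits (count_space UNIV)"
    and measurable_perform:
      "(\<lambda>(\<omega>, \<rho>). perform T \<omega> \<rho> A u)
         \<in> measurable (random_bits \<Otimes>\<^sub>M random_bits) (count_space UNIV)"
    and probe_range: "x < U \<Longrightarrow> probe T \<omega> x i < N"
    and updater_range: "in_range U N (updater T \<omega> \<rho> m u)"
    and keys_once:
      "\<lbrakk>reachable U N n T \<omega> A; i < N; j < N; A ! i = Some x; A ! j = Some x\<rbrakk> \<Longrightarrow> i = j"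
    and update_correct:
      "\<lbrakk>reachable U N n T \<omega> A; applicable U n (keys A) u\<rbrakk>
        \<Longrightarrow> keys (fst (perform T \<omega> \<rho> A u)) = apply_operation u (keys A)"
    and query_correct:
      "\<lbrakk>reachable U N n T \<omega> A; x < U\<rbrakk> \<Longrightarrow> query_correct T \<omega> A x"

primrec churn :: "nat \<Rightarrow> nat \<Rightarrow> nat set \<Rightarrow> operation list pmf" where
  "churn U 0 S = return_pmf []"
| "churn U (Suc k) S =
     bind_pmf (pmf_of_set S) (\<lambda>x.
     bind_pmf (pmf_of_set ({..<U} - (S - {x}))) (\<lambda>y.
     map_pmf (\<lambda>us. Delete x # Insert y # us) (churn U k (insert y (S - {x})))))"

definition workload :: "nat \<Rightarrow> nat \<Rightarrow> operation list pmf" where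
  "workload U n =
     bind_pmf (pmf_of_set {xs. distinct xs \<and> set xs \<subseteq> {..<U} \<and> length xs = n}) (\<lambda>xs.
     map_pmf (\<lambda>us. map Insert xs @ us) (churn U (n\<^sup>2) (set xs)))"

text \<open>An outcome consists of the permanent random bits, the fresh random bits of each operation
  and the sequence of operations; the three are independent.\<close>

definition outcomes :: "nat \<Rightarrow> nat \<Rightarrow> (bits \<times> (nat \<Rightarrow> bits) \<times> operation list) measure" where
  "outcomes U n =
     random_bits \<Otimes>\<^sub>M (PiM UNIV (\<lambda>_. random_bits) \<Otimes>\<^sub>M measure_pmf (workload U n))"

primrec state_after ::
    "nat \<Rightarrow> table \<Rightarrow> bits \<Rightarrow> (nat \<Rightarrow> bits) \<Rightarrow> operation list \<Rightarrow> nat \<Rightarrow> slots" where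
  "state_after N T \<omega> \<rho> us 0 = replicate N None"
| "state_after N T \<omega> \<rho> us (Suc t) = fst (perform T \<omega> (\<rho> t) (state_after N T \<omega> \<rho> us t) (us ! t))"

definition update_time ::
    "nat \<Rightarrow> table \<Rightarrow> bits \<Rightarrow> (nat \<Rightarrow> bits) \<Rightarrow> operation list \<Rightarrow> nat \<Rightarrow> nat" where
  "update_time N T \<omega> \<rho> us t = snd (perform T \<omega> (\<rho> t) (state_after N T \<omega> \<rho> us t) (us ! t))"

text \<open>Average over the \<open>2 * n\<^sup>2\<close> deletions and insertions that follow the \<open>n\<close> initial
  insertions.\<close>

definition expected_update_time :: "nat \<Rightarrow> nat \<Rightarrow> nat \<Rightarrow> table \<Rightarrow> ennreal" where
  "expected_update_time U N n T =
     (\<integral>\<^sup>+(\<omega>, \<rho>, us). (\<Sum>t = n..<n + 2 * n\<^sup>2. of_nat (update_time N T \<omega> \<rho> us t)) \<partial>outcomes U n)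
       / of_nat (2 * n\<^sup>2)"

text \<open>Time of the query for a uniformly random stored key, averaged over the states reached
  after each of the \<open>n\<^sup>2\<close> rounds.\<close>

definition expected_query_time :: "nat \<Rightarrow> nat \<Rightarrow> nat \<Rightarrow> table \<Rightarrow> ennreal" where
  "expected_query_time U N n T =
     (\<integral>\<^sup>+(\<omega>, \<rho>, us). (\<Sum>r = 1..n\<^sup>2.
          let A = state_after N T \<omega> \<rho> us (n + 2 * r)
          in (\<Sum>x\<in>keys A. of_nat (query_time T \<omega> A x)) / of_nat (card (keys A)))
        \<partial>outcomes U n)
       / of_nat (n\<^sup>2)"

text \<open>Queries do not change the table, so a bound on the amortized time of all operations is a
  common bound on both quantities.\<close>

definition expected_operation_time :: "nat \<Rightarrow> nat \<Rightarrow> nat \<Rightarrow> table \<Rightarrow> ennreal" where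
  "expected_operation_time U N n T =
     max (expected_update_time U N n T) (expected_query_time U N n T)"

text \<open>Load factor \<open>1 - \<epsilon>\<close> in the sense \<open>N = (1 + \<Theta>(\<epsilon>)) n\<close>, where \<open>a\<close> and \<open>b\<close> are the constants
  of the \<open>\<Theta>\<close>.\<close>

definition load_factor :: "real \<Rightarrow> real \<Rightarrow> real \<Rightarrow> nat \<Rightarrow> nat \<Rightarrow> bool" where
  "load_factor a b \<epsilon> N n \<longleftrightarrow>
     (1 + a * \<epsilon>) * real n \<le> real N \<and> real N \<le> (1 + b * \<epsilon>) * real n"

end

theory Submission
  imports Defs
begin

text \<open>Fix the random bits and consider a window of \<open>m\<close> rounds of the workload, leading from array
  \<open>A\<close> to array \<open>B\<close>. Every new key starts a displacement path: it sits in a slot of \<open>B\<close> whose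
  occupant in \<open>A\<close>, unless deleted, sits in another slot of \<open>B\<close>, and so on, until the path reaches a
  free slot of \<open>A\<close> or a slot of a deleted key. If the probe positions used along paths have product
  at most \<open>R\<close>, then a key reaches at most \<open>R\<^sup>2\<close> keys. Since inserted and deleted keys are random,
  for \<open>m \<lesssim> n / R\<^sup>2\<close> most of the paths must have product larger than \<open>R\<close>, and only few of
  them can profit from the \<open>O(\<epsilon> n)\<close> free slots or from the few keys with large query time. So the
  slots changed in the window carry a total of at least \<open>m log R / 2\<close>, where a slot counts
  with the logarithm of its probe position.

  This holds for \<open>R = 2 ^ (h 2 ^ j)\<close> and each \<open>j\<close> below about \<open>log log (1 / \<epsilon>)\<close>, where \<open>2 ^ h\<close>
  exceeds the average query time. A single write is relevant at scale \<open>j\<close> only if its probe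
  position is at most \<open>R\<^sup>3\<close>, so its weights relative to \<open>log R\<close> form a geometric series and it is
  charged only \<open>O(1)\<close> over all scales.\<close>

section \<open>Displacement paths\<close>

lemma length_run [simp]: "length (fst (run p A)) = length A"
  by (induction p arbitrary: A) auto

text \<open>The link between time and the argument about arrays: a read changes nothing and a write
  changes at most one slot. Only the difference between the arrays before and after an update is
  counted; contents overwritten in between are ignored.\<close>

lemma card_changed_le_run:
  "card {s. s < length A \<and> A ! s \<noteq> fst (run p A) ! s} \<le> snd (run p A)"
proof (induction p arbitrary: A)
  case (Write i v p)
  let ?B = "A[i := v]"
  have "{s. s < length A \<and> A ! s \<noteq> fst (run (Write i v p) A) ! s}
      \<subseteq> insert i {s. s < length ?B \<and> ?B ! s \<noteq> fst (run p ?B) ! s}"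
    by (auto simp: nth_list_update)
  then have "card {s. s < length A \<and> A ! s \<noteq> fst (run (Write i v p) A) ! s}
      \<le> card (insert i {s. s < length ?B \<and> ?B ! s \<noteq> fst (run p ?B) ! s})"
    by (rule card_mono[rotated]) simp
  also have "\<dots> \<le> Suc (card {s. s < length ?B \<and> ?B ! s \<noteq> fst (run p ?B) ! s})"
    by (simp add: card_insert_if)
  also have "\<dots> \<le> Suc (snd (run p ?B))"
    using Write[of ?B] by simp
  finally show ?case by simp
next
  case (Read i p)
  show ?case using Read[of "p (A ! i)" A] by simp
qed simp

definition once :: "slots \<Rightarrow> bool" where
  "once A \<longleftrightarrow> (\<forall>i j x. i < length A \<longrightarrow> j < length A \<longrightarrow> A ! i = Some x \<longrightarrow> A ! j = Some x \<longrightarrow> i = j)"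

lemma finite_keys [simp]: "finite (keys A)"
proof -
  have "keys A \<subseteq> the ` set A"
    by (force simp: keys_def)
  then show ?thesis
    by (rule finite_subset) simp
qed

lemma mem_keys_iff: "x \<in> keys A \<longleftrightarrow> (\<exists>s<length A. A ! s = Some x)"
  by (auto simp: keys_def in_set_conv_nth)

lemma sum_keys:
  fixes f :: "nat \<Rightarrow> 'a :: comm_monoid_add"
  assumes "once A"
  shows "(\<Sum>s<length A. case A ! s of None \<Rightarrow> 0 | Some x \<Rightarrow> f x) = sum f (keys A)"
proof -
  let ?I = "{s. s < length A \<and> A ! s \<noteq> None}"
  have "(\<Sum>s<length A. case A ! s of None \<Rightarrow> 0 | Some x \<Rightarrow> f x) = (\<Sum>s\<in>?I. f (the (A ! s)))"
    by (rule sum.mono_neutral_cong_right) auto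
  also have "\<dots> = sum f ((\<lambda>s. the (A ! s)) ` ?I)"
    by (rule sum.reindex[symmetric, unfolded o_def])
       (use assms in \<open>auto simp: once_def inj_on_def\<close>)
  also have "(\<lambda>s. the (A ! s)) ` ?I = keys A"
    by (auto simp: mem_keys_iff image_iff) force+
  finally show ?thesis .
qed

lemma card_free:
  assumes "once A"
  shows "card {s. s < length A \<and> A ! s = None} + card (keys A) = length A"
proof -
  have "(\<Sum>s<length A. (if A ! s = None then 1 else 0) + (case A ! s of None \<Rightarrow> 0 | Some x \<Rightarrow> 1))
      = (\<Sum>s<length A. 1::nat)"
    by (rule sum.cong) (auto split: option.splits)
  then show ?thesis
    unfolding sum.distrib sum_keys[OF assms]
    by (simp add: sum.If_cases Int_def conj_commute)
qed

text \<open>\<open>reach h A P y\<close> contains the keys of \<open>A\<close> that \<open>y\<close> reaches along displacement paths for which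
  the product of the numbers \<open>i + 2\<close> over the used probe indices \<open>i\<close> is at most \<open>P\<close>. The shift makes
  all factors at least 2 and so bounds the length of the paths.\<close>

function reach :: "(nat \<Rightarrow> nat \<Rightarrow> nat) \<Rightarrow> slots \<Rightarrow> nat \<Rightarrow> nat \<Rightarrow> nat set" where
  "reach h A P y = (\<Union>w\<in>{2..P}. case A ! h y (w - 2) of
      None \<Rightarrow> {} | Some k \<Rightarrow> insert k (reach h A (P div w) k))"
  by auto
termination
  by (relation "Wellfounded.measure (\<lambda>(_, _, P, _). P)") auto

declare reach.simps [simp del]

text \<open>Telescoping with 1/(n+1)^2 <= 1/n - 1/(n+1). Starting at 2 keeps the sum below 1, which
  closes the recursion in \<open>reach_finite_card\<close>.\<close>

lemma sum_inverse_squares_le: "1 \<le> P \<Longrightarrow> (\<Sum>w\<in>{2..P}. 1 / real w ^ 2) \<le> 1 - 1 / real P"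
proof (induction P rule: dec_induct)
  case (step n)
  have "1 / real (Suc n) ^ 2 \<le> 1 / real n - 1 / real (Suc n)"
  proof -
    have "1 / real n - 1 / real (Suc n) = 1 / (real n * real (Suc n))"
      using step by (simp add: field_simps)
    moreover have "1 / real (Suc n) ^ 2 \<le> 1 / (real n * real (Suc n))"
      unfolding power2_eq_square using step by (intro divide_left_mono mult_right_mono) auto
    ultimately show ?thesis by simp
  qed
  with step show ?case by simp
qed simp

text \<open>A first probe with factor w contributes one key and, by induction, at most (P/w)^2
  further ones. Summing over w gives at most (P - 1) + P^2 (1 - 1/P) = P^2 - 1.\<close>

lemma reach_finite_card: "finite (reach h A P y) \<and> card (reach h A P y) \<le> P\<^sup>2"
proof (induction P arbitrary: y rule: less_induct)
  case (less P)
  let ?S = "\<lambda>w. case A ! h y (w - 2) of None \<Rightarrow> {} | Some k \<Rightarrow> insert k (reach h A (P div w) k)"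
  have S: "finite (?S w) \<and> card (?S w) \<le> 1 + (P div w)\<^sup>2" if "w \<in> {2..P}" for w
  proof (cases "A ! h y (w - 2)")
    case (Some k)
    have "P div w < P" using that by auto
    from less[OF this, of k] show ?thesis
      using Some by (auto simp: card_insert_if)
  qed simp
  have fin: "finite (reach h A P y)"
    using S by (subst reach.simps) blast
  have "card (reach h A P y) \<le> (\<Sum>w\<in>{2..P}. card (?S w))"
    by (subst reach.simps) (rule card_UN_le, simp)
  also have "\<dots> \<le> (\<Sum>w\<in>{2..P}. 1 + (P div w)\<^sup>2)"
    by (rule sum_mono) (use S in blast)
  finally have le: "card (reach h A P y) \<le> (\<Sum>w\<in>{2..P}. 1 + (P div w)\<^sup>2)" .
  have "card (reach h A P y) \<le> P\<^sup>2"
  proof (cases "P = 0")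
    case False
    have "real (\<Sum>w\<in>{2..P}. 1 + (P div w)\<^sup>2) \<le> (\<Sum>w\<in>{2..P}. 1 + (real P / real w)\<^sup>2)"
      unfolding of_nat_sum by (rule sum_mono) (simp add: power_mono of_nat_div_le_of_nat)
    also have "\<dots> = real (P - 1) + (real P)\<^sup>2 * (\<Sum>w\<in>{2..P}. 1 / real w ^ 2)"
      by (simp add: sum.distrib sum_distrib_left power_divide)
    also have "\<dots> \<le> real (P - 1) + (real P)\<^sup>2 * (1 - 1 / real P)"
      using sum_inverse_squares_le[of P] False by (intro add_left_mono mult_left_mono) auto
    also have "\<dots> \<le> real (P\<^sup>2)"
      using False by (simp add: power2_eq_square algebra_simps)
    finally show ?thesis using le by linarith
  qed (use le in simp)
  with fin show ?case by simp
qed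

lemma reach_mono: "P \<le> P' \<Longrightarrow> reach h A P y \<subseteq> reach h A P' y"
proof (induction P arbitrary: P' y rule: less_induct)
  case (less P)
  have "reach h A (P div w) k \<subseteq> reach h A (P' div w) k" if "w \<in> {2..P}" for w k
    using that less.prems by (intro less.IH div_le_mono) auto
  then show ?case
    unfolding reach.simps[of h A P y] reach.simps[of h A P' y] using less.prems
    by (intro UN_mono) (auto split: option.splits)
qed

lemma reach_step:
  assumes "A ! h y i = Some k" and "1 \<le> p"
  shows "insert k (reach h A p k) \<subseteq> reach h A ((i + 2) * p) y"
proof -
  have "(i + 2) * 1 \<le> (i + 2) * p" using assms(2) by (rule mult_le_mono2)
  then have "i + 2 \<in> {2..(i + 2) * p}" by simp
  moreover have "(i + 2) * p div (i + 2) = p" by (rule nonzero_mult_div_cancel_left) simp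
  ultimately have "insert k (reach h A p k) = (case A ! h y (i + 2 - 2) of None \<Rightarrow> {}
      | Some k \<Rightarrow> insert k (reach h A ((i + 2) * p div (i + 2)) k))"
    using assms(1) by (simp only: diff_add_inverse2 option.case)
  also have "\<dots> \<subseteq> reach h A ((i + 2) * p) y"
    unfolding reach.simps[of h A "(i + 2) * p" y]
    by (rule UN_upper[of "i + 2" _ "\<lambda>w. case A ! h y (w - 2) of None \<Rightarrow> {}
      | Some k \<Rightarrow> insert k (reach h A ((i + 2) * p div w) k)"]) fact
  finally show ?thesis .
qed

text \<open>Meaningful only if \<open>s\<close> occurs in the probe sequence of \<open>x\<close>.
  For the slot in which a key is stored this is ensured by
  \<open>probe_rank_less_query_time\<close>.\<close>

definition probe_rank :: "(nat \<Rightarrow> nat \<Rightarrow> nat) \<Rightarrow> nat \<Rightarrow> nat \<Rightarrow> nat" where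
  "probe_rank h x s = (LEAST i. h x i = s)"

text \<open>The logarithm of the factor that \<open>reach\<close> assigns to this probe. Ranks from
  \<open>T\<close> on get weight 0: such slots are few because of the query time and are counted
  separately, and the truncation is what makes the sum over all scales converge.\<close>

definition displacement_weight ::
    "(nat \<Rightarrow> nat \<Rightarrow> nat) \<Rightarrow> nat \<Rightarrow> nat \<Rightarrow> nat option \<Rightarrow> real" where
  "displacement_weight h T s v = (case v of None \<Rightarrow> 0
     | Some x \<Rightarrow> if probe_rank h x s < T then log 2 (real (probe_rank h x s + 2)) else 0)"

lemma displacement_weight_nonneg: "0 \<le> displacement_weight h T s v"
  by (auto simp: displacement_weight_def split: option.split)

text \<open>No paths are followed: \<open>v k\<close> is the least product with which \<open>k\<close> reaches a deleted key, cut
  off at \<open>R\<close>. Summing \<open>log v\<close> of the occupant over the slots of \<open>B\<close> and subtracting the same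
  sum for \<open>A\<close> leaves the sum over the new keys, while each changed slot contributes at most its
  weight to the difference.\<close>

lemma log_new_keys_le:
  assumes [simp]: "length B = length A"
    and once: "once A" "once B"
    and on_probe: "\<And>s x. s < length A \<Longrightarrow> B ! s = Some x \<Longrightarrow> h x (probe_rank h x s) = s"
    and R: "1 \<le> R"
  defines "X \<equiv> keys A - keys B" and "Y \<equiv> keys B - keys A"
  shows "log 2 R * card Y \<le>
      (\<Sum>s\<in>{s. s < length A \<and> A ! s \<noteq> B ! s}. displacement_weight h T s (B ! s))
      + log 2 R * (card {y \<in> Y. reach h A R y \<inter> X \<noteq> {}} + card {s. s < length A \<and> A ! s = None}
        + card {s. s < length A \<and> (\<exists>x. B ! s = Some x \<and> T \<le> probe_rank h x s)})"
proof -
  let ?N = "length A"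
  define v where "v k = (LEAST p. p = R \<or> (reach h A p k \<inter> X \<noteq> {}))" for k
  define V where "V k = log 2 (real (v k))" for k
  have vI: "v k = R \<or> (reach h A (v k) k \<inter> X \<noteq> {})" for k
    unfolding v_def by (rule LeastI[of _ R]) simp
  have v_le: "v k \<le> p" if "p = R \<or> (reach h A p k \<inter> X \<noteq> {})" for k p
    unfolding v_def using that by (rule Least_le)
  have v_pos: "1 \<le> v k" for k
  proof (rule ccontr)
    assume "\<not> 1 \<le> v k"
    then have "v k = 0" by simp
    then show False using vI[of k] R by (simp add: reach.simps)
  qed
  have V_nonneg: "0 \<le> V k" for k
    unfolding V_def using v_pos[of k] by simp
  have V_le: "V k \<le> log 2 R" for k
    unfolding V_def using v_pos[of k] v_le[of R k] by simp
  \<comment> \<open>\<open>V\<close> is a distance to the deleted keys with edge length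
    \<open>log 2 (i + 2)\<close>, capped at \<open>log 2 R\<close>; this is its triangle
    inequality.\<close>
  have step1: "V x \<le> log 2 (real (i + 2)) + V k" if "A ! h x i = Some k" for x i k
  proof -
    have "v x \<le> (i + 2) * v k"
    proof (cases "v k = R")
      case True
      have "v x \<le> R" by (rule v_le) simp
      then show ?thesis using True by (auto intro: order_trans)
    next
      case False
      then have "reach h A (v k) k \<inter> X \<noteq> {}" using vI by blast
      then show ?thesis
        by (intro v_le) (use reach_step[of A h x i k "v k"] that v_pos[of k] in blast)
    qed
    then have "real (v x) \<le> real (i + 2) * real (v k)"
      by (metis of_nat_le_iff of_nat_mult)
    then have "V x \<le> log 2 (real (i + 2) * real (v k))"
      unfolding V_def using v_pos[of x] by (subst log_le_cancel_iff) auto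
    also have "\<dots> = log 2 (real (i + 2)) + V k"
      unfolding V_def using v_pos[of k] by (subst log_mult) auto
    finally show ?thesis .
  qed
  \<comment> \<open>A path may end at the deleted key \<open>k\<close>, so the single edge suffices;
    the remaining product 1 allows no further edge.\<close>
  have step2: "V x \<le> log 2 (real (i + 2))" if "A ! h x i = Some k" "k \<in> X" for x i k
  proof -
    have "v x \<le> i + 2"
      by (rule v_le) (use reach_step[of A h x i k 1] that in auto)
    then show ?thesis
      unfolding V_def using v_pos[of x] by (subst log_le_cancel_iff) auto
  qed
  \<comment> \<open>A deleted occupant counts 0 because paths end there, so the sum of
    \<open>fA\<close> runs over the surviving keys only.\<close>
  define fA where "fA s = (case A ! s of None \<Rightarrow> 0 | Some x \<Rightarrow> if x \<in> X then 0 else V x)" for s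
  define fB where "fB s = (case B ! s of None \<Rightarrow> 0 | Some x \<Rightarrow> V x)" for s
  define far where "far s \<longleftrightarrow> (\<exists>x. B ! s = Some x \<and> T \<le> probe_rank h x s)" for s
  \<comment> \<open>A free slot of \<open>A\<close> or a far key pays \<open>log 2 R\<close>
    outright. An occupied unchanged slot has equal terms on both sides, as its occupant lies in
    \<open>keys B\<close> and so outside \<open>X\<close>. Any other occupied slot pays its weight
    by \<open>step1\<close> or \<open>step2\<close>.\<close>
  have slot: "fB s \<le> fA s + (if A ! s \<noteq> B ! s then displacement_weight h T s (B ! s) else 0)
      + log 2 R * ((if A ! s = None then 1 else 0) + (if far s then 1 else 0))" if s: "s < ?N" for s
  proof -
    have nn: "0 \<le> fA s" "0 \<le> displacement_weight h T s (B ! s)" "0 \<le> log 2 (real R)"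
      using R V_nonneg by (auto simp: fA_def displacement_weight_nonneg split: option.split)
    show ?thesis
    proof (cases "B ! s")
      case None
      then show ?thesis using nn by (simp add: fB_def)
    next
      case B: (Some x)
      show ?thesis
      proof (cases "A ! s = None \<or> far s")
        case True
        then show ?thesis using nn V_le[of x] B by (auto simp: fB_def)
      next
        case False
        then obtain k where A: "A ! s = Some k" by auto
        have probe_rank: "h x (probe_rank h x s) = s" using on_probe[OF s B] .
        have w: "displacement_weight h T s (B ! s) = log 2 (real (probe_rank h x s + 2))"
          using False B by (auto simp: far_def displacement_weight_def)
        show ?thesis
        proof (cases "k = x")
          case True
          have "x \<in> keys B" using B s by (auto simp: mem_keys_iff)
          then have "x \<notin> X" by (simp add: X_def)
          then show ?thesis using True A B False by (simp add: fA_def fB_def)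
        next
          case neq: False
          have "V x \<le> log 2 (real (probe_rank h x s + 2)) + V k" "k \<in> X \<longrightarrow> V x \<le> log 2 (real (probe_rank h x s + 2))"
            using step1[of x "probe_rank h x s" k] step2[of x "probe_rank h x s" k] probe_rank A by auto
          then show ?thesis using neq A B False w by (auto simp: fA_def fB_def)
        qed
      qed
    qed
  qed
  have "(\<Sum>s<?N. fB s) \<le> (\<Sum>s<?N. fA s + (if A ! s \<noteq> B ! s then displacement_weight h T s (B ! s) else 0)
      + log 2 R * ((if A ! s = None then 1 else 0) + (if far s then 1 else 0)))"
    by (rule sum_mono) (use slot in auto)
  also have "\<dots> = (\<Sum>s<?N. fA s)
      + (\<Sum>s\<in>{s. s < ?N \<and> A ! s \<noteq> B ! s}. displacement_weight h T s (B ! s))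
      + log 2 R * (card {s. s < ?N \<and> A ! s = None} + card {s. s < ?N \<and> far s})"
    by (simp add: sum.distrib sum_distrib_left[symmetric] sum.If_cases Int_def conj_commute)
  also have "(\<Sum>s<?N. fA s) = (\<Sum>x\<in>keys A. if x \<in> X then 0 else V x)"
    unfolding fA_def by (rule sum_keys[OF once(1)])
  also have "\<dots> = sum V (keys A \<inter> keys B)"
    by (rule sum.mono_neutral_cong_right) (auto simp: X_def)
  also have "(\<Sum>s<?N. fB s) = sum V (keys B)"
    unfolding fB_def using sum_keys[OF once(2), of V] by simp
  \<comment> \<open>The surviving keys occur on both sides and cancel, wherever they have been
    moved. Only the new keys remain.\<close>
  also have "sum V (keys B) = sum V (keys A \<inter> keys B) + sum V Y"
    unfolding Y_def by (subst sum.union_disjoint[symmetric]) (auto intro!: arg_cong[of _ _ "sum V"])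
  finally have main: "sum V Y \<le>
      (\<Sum>s\<in>{s. s < ?N \<and> A ! s \<noteq> B ! s}. displacement_weight h T s (B ! s))
      + log 2 R * (card {s. s < ?N \<and> A ! s = None} + card {s. s < ?N \<and> far s})"
    by simp
  let ?H = "{y \<in> Y. reach h A R y \<inter> X \<noteq> {}}"
  have finY: "finite Y" by (simp add: Y_def)
  \<comment> \<open>A new key that reaches no deleted key within product \<open>R\<close> sits at
    the cutoff and contributes the full \<open>log 2 R\<close>.\<close>
  have "V y = log 2 R" if "y \<in> Y - ?H" for y
  proof -
    have "v y \<le> R" by (rule v_le) simp
    then have "reach h A (v y) y \<subseteq> reach h A R y" by (rule reach_mono)
    then have "v y = R" using vI[of y] that by blast
    then show ?thesis by (simp add: V_def)
  qed
  then have "log 2 R * card (Y - ?H) = sum V (Y - ?H)" by simp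
  also have "\<dots> \<le> sum V Y" by (rule sum_mono2) (use finY V_nonneg in auto)
  also have "card (Y - ?H) = card Y - card ?H"
    by (rule card_Diff_subset) (use finY in auto)
  finally have "log 2 R * (real (card Y) - real (card ?H)) \<le> sum V Y"
    by (simp add: card_mono finY)
  with main show ?thesis
    unfolding far_def by (simp add: algebra_simps)
qed

section \<open>The random workload\<close>

primrec valid :: "nat \<Rightarrow> nat \<Rightarrow> nat set \<Rightarrow> operation list \<Rightarrow> bool" where
  "valid U n S [] \<longleftrightarrow> True"
| "valid U n S (u # us) \<longleftrightarrow> applicable U n S u \<and> valid U n (apply_operation u S) us"

lemma valid_append:
  "valid U n S (us @ vs) \<longleftrightarrow> valid U n S us \<and> valid U n (fold apply_operation us S) vs"
  by (induction us arbitrary: S) auto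

text \<open>Conditioning on the first random choice, with only an upper bound known for the inner
  expectation. Finite supports settle integrability.\<close>

lemma expectation_bind_le:
  fixes f :: "'b \<Rightarrow> real"
  assumes "finite (set_pmf p)" and "\<And>x. x \<in> set_pmf p \<Longrightarrow> finite (set_pmf (q x))"
    and "\<And>x. x \<in> set_pmf p \<Longrightarrow> measure_pmf.expectation (q x) f \<le> g x"
  shows "measure_pmf.expectation (bind_pmf p q) f \<le> measure_pmf.expectation p g"
proof -
  define q' where "q' x = (if x \<in> set_pmf p then q x else return_pmf undefined)" for x
  have "bind_pmf p q = bind_pmf p q'"
    by (rule bind_pmf_cong) (auto simp: q'_def)
  also have "measure_pmf.expectation \<dots> f
      = (\<Sum>x\<in>set_pmf p. pmf p x *\<^sub>R measure_pmf.expectation (q' x) f)"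
    by (rule pmf_expectation_bind) (use assms in \<open>auto simp: q'_def\<close>)
  also have "\<dots> \<le> (\<Sum>x\<in>set_pmf p. pmf p x *\<^sub>R g x)"
    by (intro sum_mono scaleR_left_mono) (use assms in \<open>auto simp: q'_def\<close>)
  also have "\<dots> = measure_pmf.expectation p g"
    by (rule integral_measure_pmf[symmetric]) (use assms in auto)
  finally show ?thesis .
qed

lemma finite_expectation_mono:
  fixes f g :: "'a \<Rightarrow> real"
  assumes "finite (set_pmf p)" and "\<And>x. x \<in> set_pmf p \<Longrightarrow> f x \<le> g x"
  shows "measure_pmf.expectation p f \<le> measure_pmf.expectation p g"
  using assms by (intro integral_mono_AE integrable_measure_pmf_finite AE_pmfI) auto

section \<open>Support and Markov property of the workload\<close>

locale churning =
  fixes U n :: nat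
  assumes n_pos: "1 \<le> n" and n_le: "n \<le> U"
begin

definition full :: "nat set \<Rightarrow> bool" where
  "full S \<longleftrightarrow> S \<subseteq> {..<U} \<and> card S = n"

lemma full_finite: "full S \<Longrightarrow> finite S"
  by (auto simp: full_def intro: finite_subset)

lemma full_nonempty: "full S \<Longrightarrow> S \<noteq> {}"
  using n_pos by (auto simp: full_def)

text \<open>The new key is drawn after the deletion, so the key \<open>x\<close> just deleted is
  again a candidate; hence the \<open>Suc\<close>.\<close>

lemma exchange_set:
  assumes "full S" "x \<in> S"
  shows "finite ({..<U} - (S - {x}))" and "{..<U} - (S - {x}) \<noteq> {}"
    and "card ({..<U} - (S - {x})) = Suc (U - n)"
proof -
  have "{..<U} - (S - {x}) = insert x ({..<U} - S)" using assms by (auto simp: full_def)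
  moreover have "card ({..<U} - S) = U - n"
    using assms full_finite by (subst card_Diff_subset) (auto simp: full_def)
  ultimately show "card ({..<U} - (S - {x})) = Suc (U - n)"
    using assms by simp
qed (use assms in \<open>auto simp: full_def\<close>)

lemma full_exchange:
  assumes "full S" "x \<in> S" "y \<in> {..<U} - (S - {x})"
  shows "full (insert y (S - {x}))"
  using assms n_pos full_finite[OF assms(1)] by (auto simp: full_def card_insert_if)

text \<open>The last claim places the insertions at the odd positions and so yields their number
  \<open>k\<close>, which is needed to apply \<open>churn_cost_ge\<close>.\<close>

lemma churn_support:
  assumes "full S" "us \<in> set_pmf (churn U k S)"
  shows "length us = 2 * k" and "valid U n S us" and "full (fold apply_operation us S)"
    and "{i. i < length us \<and> (\<exists>y. us ! i = Insert y)} = (\<lambda>i. 2 * i + 1) ` {..<k}"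
proof -
  have "length us = 2 * k \<and> valid U n S us \<and> full (fold apply_operation us S)
    \<and> (\<forall>i<k. \<exists>x y. us ! (2 * i) = Delete x \<and> us ! (2 * i + 1) = Insert y)"
    using assms
  proof (induction k arbitrary: S us)
    case (Suc k)
    then obtain x y us' where x: "x \<in> S" and y: "y \<in> {..<U} - (S - {x})"
      and us': "us' \<in> set_pmf (churn U k (insert y (S - {x})))"
      and us: "us = Delete x # Insert y # us'"
      using full_finite full_nonempty exchange_set[OF Suc.prems(1)]
      by (auto simp: set_pmf_of_set)
    have "card (S - {x}) < n"
      using Suc.prems(1) x n_pos full_finite by (auto simp: full_def)
    with Suc.IH[OF full_exchange[OF Suc.prems(1) x y] us'] x y us show ?case
      by (auto simp: nth_Cons' less_Suc_eq_0_disj)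
  qed (auto simp: full_def)
  then have len: "length us = 2 * k" and op: "\<And>i. i < k \<Longrightarrow> \<exists>x y. us ! (2 * i) = Delete x \<and> us ! (2 * i + 1) = Insert y"
    and "valid U n S us" "full (fold apply_operation us S)"
    by auto
  then show "length us = 2 * k" "valid U n S us" "full (fold apply_operation us S)" by auto
  show "{i. i < length us \<and> (\<exists>y. us ! i = Insert y)} = (\<lambda>i. 2 * i + 1) ` {..<k}"
  proof (intro equalityI subsetI)
    fix i assume i: "i \<in> {i. i < length us \<and> (\<exists>y. us ! i = Insert y)}"
    have "i div 2 < k" using i len by auto
    moreover have "i \<noteq> 2 * (i div 2)" using op[OF \<open>i div 2 < k\<close>] i by auto
    ultimately show "i \<in> (\<lambda>i. 2 * i + 1) ` {..<k}"
      by (intro image_eqI[of _ _ "i div 2"]) (presburger, simp)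
  next
    fix i assume "i \<in> (\<lambda>i. 2 * i + 1) ` {..<k}"
    then obtain j where j: "j < k" "i = 2 * j + 1" by auto
    from op[OF j(1)] j len show "i \<in> {i. i < length us \<and> (\<exists>y. us ! i = Insert y)}" by auto
  qed
qed

lemma finite_churn: "full S \<Longrightarrow> finite (set_pmf (churn U k S))"
proof (induction k arbitrary: S)
  case (Suc k)
  then show ?case
    using full_finite[OF Suc.prems] full_nonempty[OF Suc.prems] exchange_set[OF Suc.prems]
      full_exchange[OF Suc.prems]
    by (auto simp: set_pmf_of_set)
qed auto

text \<open>Markov property: the later rounds depend on the earlier ones only through the current
  key set.\<close>

lemma churn_add:
  "churn U (r + k) S = bind_pmf (churn U r S)
    (\<lambda>us. map_pmf ((@) us) (churn U k (fold apply_operation us S)))"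
proof (induction r arbitrary: S)
  case 0
  show ?case by (simp add: bind_return_pmf map_pmf_def bind_return_pmf')
next
  case (Suc r)
  have [simp]: "(@) (u # v # us) = (\<lambda>vs. u # v # us @ vs)" for u v :: operation and us
    by auto
  show ?case
    by (simp add: Suc map_bind_pmf bind_map_pmf bind_assoc_pmf pmf.map_comp o_def)
qed

definition initial_sequences :: "nat list set" where
  "initial_sequences = {xs. distinct xs \<and> set xs \<subseteq> {..<U} \<and> length xs = n}"

lemma initial_sequences: "finite initial_sequences" "initial_sequences \<noteq> {}"
proof -
  have "initial_sequences \<subseteq> {xs. set xs \<subseteq> {..<U} \<and> length xs = n}"
    by (auto simp: initial_sequences_def)
  then show "finite initial_sequences"
    using finite_lists_length_eq[of "{..<U}" n] by (auto intro: finite_subset)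
  have "[0..<n] \<in> initial_sequences"
    using n_le by (auto simp: initial_sequences_def)
  then show "initial_sequences \<noteq> {}" by auto
qed

lemma fold_insert_keys: "fold apply_operation (map Insert xs) S = set xs \<union> S"
  by (induction xs arbitrary: S) auto

lemma valid_inserts:
  "distinct xs \<Longrightarrow> set xs \<subseteq> {..<U} \<Longrightarrow> set xs \<inter> S = {} \<Longrightarrow> finite S \<Longrightarrow>
    card S + length xs \<le> n \<Longrightarrow> valid U n S (map Insert xs)"
  by (induction xs arbitrary: S) auto

definition prefix_workload :: "nat \<Rightarrow> operation list pmf" where
  "prefix_workload r = bind_pmf (pmf_of_set initial_sequences)
     (\<lambda>xs. map_pmf ((@) (map Insert xs)) (churn U r (set xs)))"

lemma workload_eq: "workload U n = prefix_workload (n\<^sup>2)"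
  by (simp add: workload_def prefix_workload_def initial_sequences_def)

lemma full_initial: "xs \<in> initial_sequences \<Longrightarrow> full (set xs)"
  by (auto simp: initial_sequences_def full_def distinct_card)

lemma prefix_workload_support:
  assumes "us \<in> set_pmf (prefix_workload r)"
  shows "length us = n + 2 * r" and "valid U n {} us" and "full (fold apply_operation us {})"
proof -
  from assms obtain xs us' where xs: "xs \<in> initial_sequences"
    and us': "us' \<in> set_pmf (churn U r (set xs))" and us: "us = map Insert xs @ us'"
    using initial_sequences by (auto simp: prefix_workload_def set_pmf_of_set)
  note supp = churn_support[OF full_initial[OF xs] us']
  show "length us = n + 2 * r"
    using supp us xs by (simp add: initial_sequences_def)
  show "valid U n {} us"
    using supp us xs valid_inserts[of xs "{}"]
    by (auto simp: initial_sequences_def valid_append fold_insert_keys)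
  show "full (fold apply_operation us {})"
    using supp us by (simp add: fold_insert_keys)
qed

lemma finite_prefix_workload: "finite (set_pmf (prefix_workload r))"
  using initial_sequences finite_churn full_initial
  by (auto simp: prefix_workload_def set_pmf_of_set)

lemma prefix_workload_add:
  "prefix_workload (r + k) = bind_pmf (prefix_workload r)
    (\<lambda>us. map_pmf ((@) us) (churn U k (fold apply_operation us {})))"
proof -
  have [simp]: "(@) (us @ vs) = (\<lambda>ws. us @ vs @ ws)" for us vs :: "operation list"
    by auto
  show ?thesis
    unfolding prefix_workload_def churn_add
    by (simp add: map_bind_pmf bind_map_pmf bind_assoc_pmf pmf.map_comp o_def fold_insert_keys)
qed

text \<open>Given the history before it, a window is a fresh churn started from the current key set.
  The rounds after the window do not affect the pair and drop out.\<close>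

lemma workload_window:
  assumes "r + m \<le> n\<^sup>2"
  shows "map_pmf (\<lambda>us. (take (n + 2 * r) us, take (2 * m) (drop (n + 2 * r) us))) (workload U n)
    = bind_pmf (prefix_workload r)
        (\<lambda>ps. map_pmf (Pair ps) (churn U m (fold apply_operation ps {})))"
proof -
  obtain k where k: "n\<^sup>2 = (r + m) + k" using assms le_Suc_ex by blast
  let ?cut = "\<lambda>us. (take (n + 2 * r) us, take (2 * m) (drop (n + 2 * r) us))"
  let ?after = "\<lambda>us. fold apply_operation us {}"
  have "map_pmf ?cut (workload U n) = bind_pmf (prefix_workload r) (\<lambda>ps.
      bind_pmf (churn U m (?after ps)) (\<lambda>vs.
      map_pmf (\<lambda>zs. ?cut (ps @ vs @ zs)) (churn U k (?after (ps @ vs)))))"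
    unfolding workload_eq k add.assoc prefix_workload_add churn_add
    by (simp add: map_bind_pmf bind_map_pmf bind_assoc_pmf pmf.map_comp o_def)
  also have "\<dots> = bind_pmf (prefix_workload r) (\<lambda>ps.
      bind_pmf (churn U m (?after ps)) (\<lambda>vs.
      map_pmf (\<lambda>zs. (ps, vs)) (churn U k (?after (ps @ vs)))))"
  proof (intro bind_pmf_cong map_pmf_cong refl)
    fix ps vs zs
    assume "ps \<in> set_pmf (prefix_workload r)" "vs \<in> set_pmf (churn U m (?after ps))"
    then have "length ps = n + 2 * r" "length vs = 2 * m"
      using prefix_workload_support churn_support by blast+
    then show "?cut (ps @ vs @ zs) = (ps, vs)" by simp
  qed
  also have "\<dots> = bind_pmf (prefix_workload r) (\<lambda>ps. map_pmf (Pair ps) (churn U m (?after ps)))"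
    by (simp add: map_pmf_def)
  finally show ?thesis .
qed

lemma workload_window_support:
  assumes "r + m \<le> n\<^sup>2" and "us \<in> set_pmf (workload U n)"
  shows "take (n + 2 * r) us \<in> set_pmf (prefix_workload r)"
    and "take (2 * m) (drop (n + 2 * r) us)
      \<in> set_pmf (churn U m (fold apply_operation (take (n + 2 * r) us) {}))"
proof -
  have "(take (n + 2 * r) us, take (2 * m) (drop (n + 2 * r) us))
      \<in> set_pmf (map_pmf (\<lambda>us. (take (n + 2 * r) us, take (2 * m) (drop (n + 2 * r) us))) (workload U n))"
    using assms(2) by auto
  then show "take (n + 2 * r) us \<in> set_pmf (prefix_workload r)"
    and "take (2 * m) (drop (n + 2 * r) us)
      \<in> set_pmf (churn U m (fold apply_operation (take (n + 2 * r) us) {}))"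
    unfolding workload_window[OF assms(1)] by auto
qed

text \<open>It suffices to bound the expectation for each fixed history. Since \<open>f\<close> may
  depend on the history, the array at the start of a window can be treated as fixed while the window
  is drawn.\<close>

lemma expectation_window_le:
  fixes f :: "operation list \<Rightarrow> operation list \<Rightarrow> real"
  assumes "r + m \<le> n\<^sup>2"
    and le: "\<And>ps. ps \<in> set_pmf (prefix_workload r) \<Longrightarrow>
      measure_pmf.expectation (churn U m (fold apply_operation ps {})) (f ps) \<le> c"
  shows "measure_pmf.expectation (workload U n)
    (\<lambda>us. f (take (n + 2 * r) us) (take (2 * m) (drop (n + 2 * r) us))) \<le> c"
proof -
  have "measure_pmf.expectation (workload U n)
        (\<lambda>us. f (take (n + 2 * r) us) (take (2 * m) (drop (n + 2 * r) us)))
      = measure_pmf.expectation (map_pmf (\<lambda>us. (take (n + 2 * r) us,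
          take (2 * m) (drop (n + 2 * r) us))) (workload U n)) (\<lambda>(ps, vs). f ps vs)"
    by simp
  also have "\<dots> \<le> measure_pmf.expectation (prefix_workload r) (\<lambda>_. c)"
    unfolding workload_window[OF assms(1)]
    by (rule expectation_bind_le)
       (use finite_prefix_workload finite_churn prefix_workload_support le in auto)
  finally show ?thesis by simp
qed

end

text \<open>Counts the pairs of an inserted key \<open>y\<close> and a deleted key in \<open>G y\<close>, in either order of time,
  and the rounds that fail to move the key set further away from \<open>S\<^sub>0\<close>. The sets \<open>I\<close> and \<open>D\<close>
  collect the keys inserted and deleted so far.\<close>

primrec churn_cost ::
    "(nat \<Rightarrow> nat set) \<Rightarrow> nat set \<Rightarrow> nat set \<Rightarrow> nat set \<Rightarrow> operation list \<Rightarrow> nat" where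
  "churn_cost G S\<^sub>0 I D [] = 0"
| "churn_cost G S\<^sub>0 I D (u # us) = (case u of
      Delete x \<Rightarrow> of_bool (x \<notin> S\<^sub>0) + card {y \<in> I. x \<in> G y} + churn_cost G S\<^sub>0 I (insert x D) us
    | Insert y \<Rightarrow> of_bool (y \<in> S\<^sub>0) + card (G y \<inter> D) + churn_cost G S\<^sub>0 (insert y I) D us)"

lemma card_insert_le_Suc: "card (insert x A) \<le> card A + 1"
  by (cases "finite A") (auto simp: card_insert_if)

text \<open>\<open>I'\<close> and \<open>D'\<close> stand for the final values of \<open>I\<close>
  and \<open>D\<close>. A pair of an inserted and a deleted key is charged when the later of the two
  operations occurs. An insertion increases \<open>card (S - S\<^sub>0)\<close> unless the key is in
  \<open>S\<^sub>0\<close>, and a deletion decreases it only if the key is outside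
  \<open>S\<^sub>0\<close>; both bad cases are charged.\<close>

lemma churn_cost_ge_aux:
  assumes "valid U n S us" "finite I" "finite D" "finite S"
  shows "\<exists>I' D'. finite I' \<and> finite D' \<and> I \<subseteq> I' \<and> D \<subseteq> D' \<and> fold apply_operation us S - S \<subseteq> I' \<and> S - fold apply_operation us S \<subseteq> D'
    \<and> (\<Sum>y\<in>I'. card (G y \<inter> D')) + card {i. i < length us \<and> (\<exists>y. us ! i = Insert y)} + card (S - S\<^sub>0)
      \<le> card (fold apply_operation us S - S\<^sub>0) + churn_cost G S\<^sub>0 I D us + (\<Sum>y\<in>I. card (G y \<inter> D))"
  using assms
proof (induction us arbitrary: S I D)
  case Nil
  then show ?case by (intro exI[of _ I] exI[of _ D]) auto
next
  case (Cons u us)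
  have split: "{i. i < length (u # us) \<and> (\<exists>y. (u # us) ! i = Insert y)}
      = (if \<exists>y. u = Insert y then {0} else {}) \<union> Suc ` {i. i < length us \<and> (\<exists>y. us ! i = Insert y)}"
    (is "?L = ?R")
  proof (rule set_eqI)
    fix i show "i \<in> ?L \<longleftrightarrow> i \<in> ?R" by (cases i) auto
  qed
  have ins: "card {i. i < length (u # us) \<and> (\<exists>y. (u # us) ! i = Insert y)}
      = of_bool (\<exists>y. u = Insert y) + card {i. i < length us \<and> (\<exists>y. us ! i = Insert y)}"
    unfolding split by (subst card_Un_disjoint) (auto simp: card_image)
  show ?case
  proof (cases u)
    case (Delete x)
    have x: "x \<in> S" using Cons.prems Delete by simp
    have fin: "finite (S - {x})" "finite (insert x D)" using Cons.prems by auto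
    have eq: "fold apply_operation (u # us) S = fold apply_operation us (S - {x})"
      by (simp add: Delete)
    from Cons.IH[of "S - {x}" I "insert x D", OF _ Cons.prems(2) fin(2) fin(1)] Cons.prems(1)
    obtain I' D' where ID: "finite I'" "finite D'" "I \<subseteq> I'" "insert x D \<subseteq> D'"
      "fold apply_operation (u # us) S - (S - {x}) \<subseteq> I'"
      "(S - {x}) - fold apply_operation (u # us) S \<subseteq> D'"
      and le: "(\<Sum>y\<in>I'. card (G y \<inter> D')) + card {i. i < length us \<and> (\<exists>y. us ! i = Insert y)}
          + card (S - {x} - S\<^sub>0)
        \<le> card (fold apply_operation (u # us) S - S\<^sub>0) + churn_cost G S\<^sub>0 I (insert x D) us
          + (\<Sum>y\<in>I. card (G y \<inter> insert x D))"
      unfolding eq by (auto simp: Delete)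
    have "(\<Sum>y\<in>I. card (G y \<inter> insert x D)) \<le> (\<Sum>y\<in>I. card (G y \<inter> D) + of_bool (x \<in> G y))"
    proof (rule sum_mono)
      fix y
      have "card (insert x (G y \<inter> D)) \<le> card (G y \<inter> D) + 1" by (rule card_insert_le_Suc)
      then show "card (G y \<inter> insert x D) \<le> card (G y \<inter> D) + of_bool (x \<in> G y)"
        by (cases "x \<in> G y") auto
    qed
    also have "\<dots> = (\<Sum>y\<in>I. card (G y \<inter> D)) + card {y \<in> I. x \<in> G y}"
      using Cons.prems(2) by (simp add: sum.distrib sum.inter_filter[symmetric] of_bool_def)
    finally have 1: "(\<Sum>y\<in>I. card (G y \<inter> insert x D))
        \<le> (\<Sum>y\<in>I. card (G y \<inter> D)) + card {y \<in> I. x \<in> G y}" .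
    have 2: "card (S - S\<^sub>0) \<le> card (S - {x} - S\<^sub>0) + of_bool (x \<notin> S\<^sub>0)"
    proof (cases "x \<in> S\<^sub>0")
      case True
      then have "S - {x} - S\<^sub>0 = S - S\<^sub>0" by auto
      then show ?thesis by simp
    next
      case False
      have "S - S\<^sub>0 = insert x (S - {x} - S\<^sub>0)" using x False by auto
      then show ?thesis using card_insert_le_Suc[of x "S - {x} - S\<^sub>0"] False by simp
    qed
    have "(\<Sum>y\<in>I'. card (G y \<inter> D'))
        + card {i. i < length (u # us) \<and> (\<exists>y. (u # us) ! i = Insert y)} + card (S - S\<^sub>0)
      \<le> card (fold apply_operation (u # us) S - S\<^sub>0) + churn_cost G S\<^sub>0 I D (u # us)
        + (\<Sum>y\<in>I. card (G y \<inter> D))"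
      using le 1 2 ins by (simp add: Delete)
    moreover have "I \<subseteq> I'" "D \<subseteq> D'" "fold apply_operation (u # us) S - S \<subseteq> I'"
      "S - fold apply_operation (u # us) S \<subseteq> D'"
      using ID(3-6) by auto
    ultimately show ?thesis using ID(1,2) by blast
  next
    case (Insert y)
    have y: "y \<notin> S" using Cons.prems Insert by simp
    have fin: "finite (insert y S)" "finite (insert y I)" using Cons.prems by auto
    have eq: "fold apply_operation (u # us) S = fold apply_operation us (insert y S)"
      by (simp add: Insert)
    from Cons.IH[of "insert y S" "insert y I" D, OF _ fin(2) Cons.prems(3) fin(1)] Cons.prems(1)
    obtain I' D' where ID: "finite I'" "finite D'" "insert y I \<subseteq> I'" "D \<subseteq> D'"
      "fold apply_operation (u # us) S - insert y S \<subseteq> I'"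
      "insert y S - fold apply_operation (u # us) S \<subseteq> D'"
      and le: "(\<Sum>y\<in>I'. card (G y \<inter> D')) + card {i. i < length us \<and> (\<exists>y. us ! i = Insert y)}
          + card (insert y S - S\<^sub>0)
        \<le> card (fold apply_operation (u # us) S - S\<^sub>0) + churn_cost G S\<^sub>0 (insert y I) D us
          + (\<Sum>y\<in>insert y I. card (G y \<inter> D))"
      unfolding eq by (auto simp: Insert)
    have 1: "(\<Sum>z\<in>insert y I. card (G z \<inter> D)) \<le> (\<Sum>z\<in>I. card (G z \<inter> D)) + card (G y \<inter> D)"
      using Cons.prems(2) by (cases "y \<in> I") (auto simp: insert_absorb)
    have 2: "card (S - S\<^sub>0) + 1 \<le> card (insert y S - S\<^sub>0) + of_bool (y \<in> S\<^sub>0)"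
    proof (cases "y \<in> S\<^sub>0")
      case True
      then show ?thesis by simp
    next
      case False
      then have "insert y S - S\<^sub>0 = insert y (S - S\<^sub>0)" by auto
      then show ?thesis using y False Cons.prems(4) by simp
    qed
    have "(\<Sum>y\<in>I'. card (G y \<inter> D'))
        + card {i. i < length (u # us) \<and> (\<exists>y. (u # us) ! i = Insert y)} + card (S - S\<^sub>0)
      \<le> card (fold apply_operation (u # us) S - S\<^sub>0) + churn_cost G S\<^sub>0 I D (u # us)
        + (\<Sum>y\<in>I. card (G y \<inter> D))"
      using le 1 2 ins by (simp add: Insert)
    moreover have "I \<subseteq> I'" "D \<subseteq> D'" "fold apply_operation (u # us) S - S \<subseteq> I'"
      "S - fold apply_operation (u # us) S \<subseteq> D'"
      using ID(3-6) by auto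
    ultimately show ?thesis using ID(1,2) by blast
  qed
qed

text \<open>The case \<open>S\<^sub>0 = S\<close> without earlier operations. Every new key with a
  vanished key in its set \<open>G y\<close> accounts for at least one charged pair.\<close>

lemma churn_cost_ge:
  assumes "valid U n S us" "finite S"
  defines "S' \<equiv> fold apply_operation us S"
  shows "card {i. i < length us \<and> (\<exists>y. us ! i = Insert y)}
    + card {y \<in> S' - S. G y \<inter> (S - S') \<noteq> {}} \<le> card (S' - S) + churn_cost G S {} {} us"
proof -
  from churn_cost_ge_aux[OF assms(1) finite.emptyI finite.emptyI assms(2), of G S]
  obtain I' D' where ID: "finite I'" "finite D'" "S' - S \<subseteq> I'" "S - S' \<subseteq> D'"
    and le: "(\<Sum>y\<in>I'. card (G y \<inter> D')) + card {i. i < length us \<and> (\<exists>y. us ! i = Insert y)}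
      \<le> card (S' - S) + churn_cost G S {} {} us"
    unfolding S'_def by auto
  let ?H = "{y \<in> S' - S. G y \<inter> (S - S') \<noteq> {}}"
  have "card ?H = (\<Sum>y\<in>?H. 1)" by simp
  also have "\<dots> \<le> (\<Sum>y\<in>?H. card (G y \<inter> D'))"
  proof (rule sum_mono)
    fix y assume "y \<in> ?H"
    then have "G y \<inter> D' \<noteq> {}" using ID by auto
    then show "1 \<le> card (G y \<inter> D')" using ID(2) by (simp add: Suc_le_eq card_gt_0_iff)
  qed
  also have "\<dots> \<le> (\<Sum>y\<in>I'. card (G y \<inter> D'))"
    by (rule sum_mono2) (use ID in auto)
  finally show ?thesis using le by simp
qed

lemma sum_card_swap:
  assumes "finite B" "finite D"
  shows "(\<Sum>x\<in>D. card {y \<in> B. x \<in> G y}) = (\<Sum>y\<in>B. card (G y \<inter> D))"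
proof -
  have "(\<Sum>x\<in>D. card {y \<in> B. x \<in> G y}) = (\<Sum>x\<in>D. \<Sum>y\<in>B. if x \<in> G y then 1 else 0)"
    using assms by (simp add: sum.inter_filter[symmetric])
  also have "\<dots> = (\<Sum>y\<in>B. \<Sum>x\<in>D. if x \<in> G y then 1 else 0)"
    by (rule sum.swap)
  also have "\<dots> = (\<Sum>y\<in>B. card (G y \<inter> D))"
    using assms by (simp add: sum.If_cases Int_commute)
  finally show ?thesis .
qed

text \<open>A deleted key is uniform given the keys inserted before it. For a key inserted after a deletion
  of \<open>x\<close>, the probability of a pair is governed by the in-degree of \<open>x\<close>, which may be large but is
  small on average over the choice of \<open>x\<close>.\<close>

lemma (in churning) expectation_churn_cost_le:
  fixes g :: real
  assumes "full S" "finite I" "finite D" "S - S\<^sub>0 \<subseteq> I" "finite S\<^sub>0" "card S\<^sub>0 \<le> n" "n < U"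
    and G: "\<And>y. finite (G y)" "\<And>y. real (card (G y)) \<le> g"
  defines "indeg \<equiv> (\<lambda>x. real (card {y \<in> {..<U}. x \<in> G y}))"
  shows "measure_pmf.expectation (churn U k S) (\<lambda>us. real (churn_cost G S\<^sub>0 I D us))
    \<le> k * ((real (card I) + k) * (1 + g) / n + n / (real U - n))
      + k * sum indeg D / (real U - n) + (real k)\<^sup>2 * (U * g / n) / (real U - n)"
    (is "_ \<le> ?\<Phi> k (card I) (sum indeg D)")
  using assms(1-4)
proof (induction k arbitrary: S I D)
  case 0
  show ?case by simp
next
  case (Suc k)
  define v where "v = real U - n"
  have v: "0 < v" using assms(7) by (simp add: v_def)
  have g: "0 \<le> g" using G(2)[of 0] by linarith
  have n: "0 < real n" using n_pos by simp
  define i where "i = real (card I)"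
  define d where "d = sum indeg D"
  define a where "a x = of_bool (x \<notin> S\<^sub>0) + real (card {y \<in> I. x \<in> G y})" for x
  \<comment> \<open>With v = U - n, a deleted key lies outside \<open>S\<^sub>0\<close> with
    probability at most |I|/n and forms at most |I| g / n pairs on average, where |I| grows by at
    most 1 per round. An inserted key lies in \<open>S\<^sub>0\<close> with probability at most n/v
    and forms on average at most d/v pairs, where d, the total in-degree of the deleted keys, grows
    by at most U g / n per round on average.\<close>
  define \<Phi> where "\<Phi> k i d = k * ((i + k) * (1 + g) / n + n / v) + k * d / v + k\<^sup>2 * (U * g / n) / v"
    for k i d :: real
  note finS = full_finite[OF Suc.prems(1)] and neS = full_nonempty[OF Suc.prems(1)]
  let ?E = "\<lambda>p. measure_pmf.expectation p (\<lambda>us. real (churn_cost G S\<^sub>0 I D us))"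
  have indeg_nonneg: "0 \<le> indeg x" for x by (simp add: indeg_def)
  have \<Phi>_mono: "\<Phi> (real k) i1 d1 \<le> \<Phi> (real k) i2 d2" if "i1 \<le> i2" "d1 \<le> d2" for i1 i2 d1 d2
    unfolding \<Phi>_def using that v n g
    by (intro add_mono mult_left_mono divide_right_mono mult_right_mono order_refl) auto
  have final: "?E (map_pmf (\<lambda>us. Delete x # Insert y # us) (churn U k (insert y (S - {x}))))
      \<le> a x + of_bool (y \<in> S\<^sub>0) + real (card (G y \<inter> insert x D)) + \<Phi> k (i + 1) (d + indeg x)"
    if x: "x \<in> S" and y: "y \<in> {..<U} - (S - {x})" for x y
  proof -
    let ?S = "insert y (S - {x})"
    have full: "full ?S" by (rule full_exchange[OF Suc.prems(1) x y])
    have "?E (map_pmf (\<lambda>us. Delete x # Insert y # us) (churn U k ?S))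
      = measure_pmf.expectation (churn U k ?S) (\<lambda>us.
          (a x + of_bool (y \<in> S\<^sub>0) + real (card (G y \<inter> insert x D)))
          + real (churn_cost G S\<^sub>0 (insert y I) (insert x D) us))"
      by (simp add: a_def add.assoc)
    also have "\<dots> = (a x + of_bool (y \<in> S\<^sub>0) + real (card (G y \<inter> insert x D)))
        + measure_pmf.expectation (churn U k ?S)
          (\<lambda>us. real (churn_cost G S\<^sub>0 (insert y I) (insert x D) us))"
      by (subst Bochner_Integration.integral_add)
         (auto intro!: integrable_measure_pmf_finite finite_churn full)
    also have "measure_pmf.expectation (churn U k ?S)
          (\<lambda>us. real (churn_cost G S\<^sub>0 (insert y I) (insert x D) us))
        \<le> \<Phi> k (real (card (insert y I))) (sum indeg (insert x D))"
      unfolding \<Phi>_def v_def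
      by (rule Suc.IH) (use full Suc.prems in auto)
    also have "\<dots> \<le> \<Phi> k (i + 1) (d + indeg x)"
    proof (rule \<Phi>_mono)
      show "real (card (insert y I)) \<le> i + 1"
        using card_insert_le_Suc[of y I] by (simp add: i_def)
      show "sum indeg (insert x D) \<le> d + indeg x"
        using Suc.prems(3) indeg_nonneg by (cases "x \<in> D") (auto simp: d_def insert_absorb)
    qed
    finally show ?thesis by simp
  qed
  have middle: "?E (bind_pmf (pmf_of_set ({..<U} - (S - {x})))
        (\<lambda>y. map_pmf (\<lambda>us. Delete x # Insert y # us) (churn U k (insert y (S - {x})))))
      \<le> a x + (n + d + indeg x) / v + \<Phi> k (i + 1) (d + indeg x)" if x: "x \<in> S" for x
  proof -
    let ?C = "{..<U} - (S - {x})"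
    note C = exchange_set[OF Suc.prems(1) x]
    have cardC: "real (card ?C) = v + 1"
      using C(3) assms(7) by (simp add: v_def)
    have "?E (bind_pmf (pmf_of_set ?C)
          (\<lambda>y. map_pmf (\<lambda>us. Delete x # Insert y # us) (churn U k (insert y (S - {x})))))
        \<le> measure_pmf.expectation (pmf_of_set ?C) (\<lambda>y. a x + of_bool (y \<in> S\<^sub>0)
            + real (card (G y \<inter> insert x D)) + \<Phi> k (i + 1) (d + indeg x))"
      by (rule expectation_bind_le)
         (use C final[OF x] finite_churn[OF full_exchange[OF Suc.prems(1) x]] in auto)
    also have "\<dots> = (\<Sum>y\<in>?C. (a x + \<Phi> k (i + 1) (d + indeg x))
        + (of_bool (y \<in> S\<^sub>0) + real (card (G y \<inter> insert x D)))) / (v + 1)"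
      using C(1,2) by (simp add: integral_pmf_of_set cardC algebra_simps)
    also have "\<dots> = a x + \<Phi> k (i + 1) (d + indeg x)
        + (\<Sum>y\<in>?C. of_bool (y \<in> S\<^sub>0) + real (card (G y \<inter> insert x D))) / (v + 1)"
      using v by (simp add: sum.distrib cardC add_divide_distrib)
    also have "(\<Sum>y\<in>?C. of_bool (y \<in> S\<^sub>0) + real (card (G y \<inter> insert x D))) \<le> n + (d + indeg x)"
    proof -
      have "(\<Sum>y\<in>?C. of_bool (y \<in> S\<^sub>0) :: real) = real (card (?C \<inter> S\<^sub>0))"
        by simp
      also have "\<dots> \<le> real (card S\<^sub>0)"
        using assms(5) by (intro of_nat_mono card_mono) auto
      also have "\<dots> \<le> n" using assms(6) by simp
      finally have 1: "(\<Sum>y\<in>?C. of_bool (y \<in> S\<^sub>0) :: real) \<le> n" .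
      have "(\<Sum>y\<in>?C. real (card (G y \<inter> insert x D))) \<le> (\<Sum>y<U. real (card (G y \<inter> insert x D)))"
        by (rule sum_mono2) auto
      also have "\<dots> = sum indeg (insert x D)"
        using sum_card_swap[of "{..<U}" "insert x D" G] Suc.prems(3)
        unfolding indeg_def of_nat_sum[symmetric] by simp
      also have "\<dots> \<le> d + indeg x"
        using Suc.prems(3) indeg_nonneg by (cases "x \<in> D") (auto simp: d_def insert_absorb)
      finally show ?thesis using 1 by (simp add: sum.distrib)
    qed
    \<comment> \<open>The \<open>v + 1\<close> candidates include the key just deleted; the bound is
      weakened to \<open>v\<close>.\<close>
    also have "(n + (d + indeg x)) / (v + 1) \<le> (n + d + indeg x) / v"
      using v sum_nonneg[of D indeg] indeg_nonneg by (auto simp: d_def intro!: frac_le add_nonneg_nonneg)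
    finally show ?thesis
      using v by (simp add: divide_right_mono)
  qed
  have cardS: "real (card S) = n" using Suc.prems(1) by (simp add: full_def)
  \<comment> \<open>\<open>\<Phi>\<close> is affine in its last argument, so the in-degree of the
    deleted key enters linearly and can be averaged over \<open>S\<close>.\<close>
  have \<Phi>_split: "\<Phi> k (i + 1) (d + indeg x) = \<Phi> k (i + 1) d + k * indeg x / v" for x
    by (simp add: \<Phi>_def algebra_simps add_divide_distrib)
  have "?E (churn U (Suc k) S) \<le> measure_pmf.expectation (pmf_of_set S)
      (\<lambda>x. a x + (n + d + indeg x) / v + \<Phi> k (i + 1) (d + indeg x))"
    unfolding churn.simps
    by (rule expectation_bind_le)
       (use middle finS neS exchange_set[OF Suc.prems(1)]
          finite_churn[OF full_exchange[OF Suc.prems(1)]] in auto)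
  also have "\<dots> = (\<Sum>x\<in>S. ((n + d) / v + \<Phi> k (i + 1) d) + (a x + (k + 1) / v * indeg x)) / n"
    unfolding \<Phi>_split
    using finS neS by (simp add: integral_pmf_of_set cardS) (simp add: algebra_simps add_divide_distrib)
  also have "\<dots> = (n + d) / v + \<Phi> k (i + 1) d + (sum a S + (k + 1) / v * sum indeg S) / n"
    using n by (simp add: sum.distrib cardS add_divide_distrib sum_distrib_left)
  \<comment> \<open>Keys of \<open>S\<close> outside \<open>S\<^sub>0\<close> were inserted earlier
    and hence lie in \<open>I\<close>; the pairs are counted from the side of \<open>I\<close>,
    where each set has at most \<open>g\<close> elements.\<close>
  also have "sum a S \<le> i + i * g"
  proof -
    have "(\<Sum>x\<in>S. of_bool (x \<notin> S\<^sub>0) :: real) = real (card (S - S\<^sub>0))"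
      using finS by (simp add: Diff_eq Compl_eq Int_def)
    also have "\<dots> \<le> i"
      unfolding i_def using Suc.prems by (intro of_nat_mono card_mono) auto
    finally have 1: "(\<Sum>x\<in>S. of_bool (x \<notin> S\<^sub>0) :: real) \<le> i" .
    have "(\<Sum>x\<in>S. real (card {y \<in> I. x \<in> G y})) = (\<Sum>y\<in>I. real (card (G y \<inter> S)))"
      using sum_card_swap[OF Suc.prems(2) finS, of G] unfolding of_nat_sum[symmetric] by simp
    also have "\<dots> \<le> (\<Sum>y\<in>I. g)"
      by (intro sum_mono order_trans[OF of_nat_mono[OF card_mono] G(2)]) (use G(1) in auto)
    also have "\<dots> = i * g" by (simp add: i_def)
    finally show ?thesis using 1 by (simp add: a_def sum.distrib)
  qed
  \<comment> \<open>Counting the edges from their sources: a single in-degree may be large, but the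
    out-degrees bound the total.\<close>
  also have "sum indeg S \<le> U * g"
  proof -
    have "sum indeg S = (\<Sum>y<U. real (card (G y \<inter> S)))"
      using sum_card_swap[OF _ finS, of "{..<U}" G] unfolding indeg_def of_nat_sum[symmetric] by simp
    also have "\<dots> \<le> (\<Sum>y<U. g)"
      by (intro sum_mono order_trans[OF of_nat_mono[OF card_mono] G(2)]) (use G(1) in auto)
    finally show ?thesis by simp
  qed
  finally have "?E (churn U (Suc k) S)
      \<le> (n + d) / v + \<Phi> k (i + 1) d + (i + i * g + (k + 1) / v * (U * g)) / n"
    using v n by (simp add: divide_right_mono mult_left_mono)
  also have "\<dots> \<le> \<Phi> (Suc k) i d"
  proof -
    \<comment> \<open>The two bracketed differences simplify to \<open>k + 1\<close> and
      \<open>k\<close>.\<close>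
    have "\<Phi> (Suc k) i d - ((n + d) / v + \<Phi> k (i + 1) d + (i + i * g + (k + 1) / v * (U * g)) / n)
        = (1 + g) / n * ((k + 1) * (i + k + 1) - k * (i + 1 + k) - i)
          + (U * g / n) / v * ((k + 1)\<^sup>2 - k\<^sup>2 - (k + 1))"
      using v n unfolding \<Phi>_def by (simp add: field_simps power2_eq_square)
    also have "\<dots> \<ge> 0"
      using v n g by (intro add_nonneg_nonneg mult_nonneg_nonneg) (auto simp: algebra_simps power2_eq_square)
    finally show ?thesis by simp
  qed
  finally show ?case unfolding \<Phi>_def v_def i_def d_def .
qed

text \<open>The universe is large enough that n/(U - n) <= 2/n and U/(U - n) <= 2. Each of the three
  remaining terms is then at most 2 m^2 g / n, and 48 m g <= n turns the total 6 m^2 g / n into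
  m/8.\<close>

lemma (in churning) expectation_churn_cost_from_start_le:
  assumes "full S" "2 \<le> n" "n\<^sup>2 \<le> U" "\<And>y. finite (G y)" "\<And>y. card (G y) \<le> g" "1 \<le> g"
    and m: "1 \<le> m" "48 * m * g \<le> n"
  shows "measure_pmf.expectation (churn U m S) (\<lambda>us. real (churn_cost G S {} {} us)) \<le> m / 8"
proof -
  have n: "0 < real n" using n_pos by simp
  have "2 * n \<le> n\<^sup>2" using assms(2) by (simp add: power2_eq_square)
  then have U: "2 * n \<le> U" using assms(3) by simp
  have nn: "(real n)\<^sup>2 \<le> real U" using assms(3) by (metis of_nat_le_iff of_nat_power)
  have "real (2 * n) \<le> real U" using U by (rule of_nat_mono)
  then have v: "real U \<le> 2 * (real U - n)" "0 < real U - n" "0 < real U" using n by simp_all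
  have "n < U" using U n_pos by linarith
  have "measure_pmf.expectation (churn U m S) (\<lambda>us. real (churn_cost G S {} {} us))
    \<le> m * ((real (card ({}::nat set)) + m) * (1 + real g) / n + n / (real U - n))
      + m * sum (\<lambda>x. real (card {y \<in> {..<U}. x \<in> G y})) {} / (real U - n)
      + (real m)\<^sup>2 * (U * real g / n) / (real U - n)"
    by (rule expectation_churn_cost_le)
       (use assms full_finite \<open>n < U\<close> in \<open>auto simp: full_def\<close>)
  also have "\<dots> = (real m)\<^sup>2 * (1 + real g) / n + m * (n / (real U - n))
      + (real m)\<^sup>2 * real g / n * (U / (real U - n))"
    by (simp add: power2_eq_square algebra_simps add_divide_distrib)
  also have "\<dots> \<le> (real m)\<^sup>2 * (2 * real g) / n + m * (2 * (real m * real g) / n) + (real m)\<^sup>2 * real g / n * 2"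
  proof (intro add_mono mult_left_mono divide_right_mono)
    show "U / (real U - n) \<le> 2" using v by (simp add: divide_simps)
    have "1 * 1 \<le> real m * real g" by (rule mult_mono) (use assms in auto)
    have "n / (real U - n) \<le> 2 / n"
      using v n nn by (simp add: divide_simps power2_eq_square)
    also have "\<dots> \<le> 2 * (real m * real g) / n"
      using n \<open>1 * 1 \<le> real m * real g\<close> by (simp add: divide_right_mono)
    finally show "n / (real U - n) \<le> 2 * (real m * real g) / n" .
  qed (use assms n in auto)
  also have "\<dots> = m * (6 * (real m * real g) / n)"
    by (simp add: power2_eq_square algebra_simps add_divide_distrib)
  also have "\<dots> \<le> m * (1 / 8)"
  proof (intro mult_left_mono)
    have "real (48 * m * g) \<le> real n" using m(2) by (rule of_nat_mono)
    then show "6 * (real m * real g) / n \<le> 1 / 8" using n by (simp add: divide_simps)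
  qed simp
  finally show ?thesis by simp
qed

section \<open>Windows of the workload\<close>

lemma sum_pairs:
  fixes a :: "nat \<Rightarrow> real"
  shows "(\<Sum>t = p..<p + 2 * m. a t) = (\<Sum>i<m. a (p + 2 * i) + a (p + 2 * i + 1))"
proof (induction m)
  case (Suc m)
  have "p + 2 * Suc m = Suc (Suc (p + 2 * m))" by simp
  then show ?case using Suc by (simp del: mult_Suc_right)
qed simp

text \<open>Every round, that is every pair of consecutive operations, lies in at most
  \<open>m\<close> of the windows of \<open>m\<close> rounds.\<close>

lemma sum_windows_le:
  fixes a :: "nat \<Rightarrow> real"
  assumes "\<And>t. 0 \<le> a t" "m \<le> K"
  shows "(\<Sum>r\<le>K - m. \<Sum>t = n + 2 * r..<n + 2 * (r + m). a t) \<le> m * (\<Sum>t = n..<n + 2 * K. a t)"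
proof -
  define b where "b i = a (n + 2 * i) + a (n + 2 * i + 1)" for i
  have b: "0 \<le> b i" for i by (simp add: b_def assms(1))
  have "(\<Sum>t = n + 2 * r..<n + 2 * (r + m). a t) = (\<Sum>i<m. b (r + i))" for r
    using sum_pairs[of a "n + 2 * r" m] by (simp add: b_def algebra_simps)
  then have "(\<Sum>r\<le>K - m. \<Sum>t = n + 2 * r..<n + 2 * (r + m). a t) = (\<Sum>r\<le>K - m. \<Sum>i<m. b (r + i))"
    by simp
  also have "\<dots> = (\<Sum>i<m. \<Sum>r\<le>K - m. b (r + i))"
    by (rule sum.swap)
  also have "\<dots> \<le> (\<Sum>i<m. \<Sum>r<K. b r)"
  proof (rule sum_mono)
    fix i assume i: "i \<in> {..<m}"
    have "(\<Sum>r\<le>K - m. b (r + i)) = sum b ((\<lambda>r. r + i) ` {..K - m})"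
      by (subst sum.reindex) auto
    also have "\<dots> \<le> sum b {..<K}"
      by (rule sum_mono2) (use i assms(2) b in auto)
    finally show "(\<Sum>r\<le>K - m. b (r + i)) \<le> (\<Sum>r<K. b r)" .
  qed
  also have "\<dots> = m * (\<Sum>t = n..<n + 2 * K. a t)"
    using sum_pairs[of a n K] by (simp add: b_def)
  finally show ?thesis .
qed

text \<open>The first nonzero term is at most \<open>c\<close>, and from there on the terms halve.
  The induction drops the first scale and halves \<open>a\<close>.\<close>

lemma sum_geometric_cutoff_le:
  fixes a c :: real
  assumes "0 \<le> a" "0 \<le> c"
  shows "(\<Sum>j<J. if a \<le> c * 2 ^ j then a / 2 ^ j else 0) \<le> 2 * c"
  using assms(1)
proof (induction J arbitrary: a)
  case 0
  show ?case using assms(2) by simp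
next
  case (Suc J)
  show ?case
  proof (cases "a \<le> c")
    case True
    have "(\<Sum>j<Suc J. if a \<le> c * 2 ^ j then a / 2 ^ j else 0) \<le> (\<Sum>j<Suc J. a / 2 ^ j)"
      by (rule sum_mono) (use Suc.prems in auto)
    also have "\<dots> = 2 * a * (1 - 1 / 2 ^ Suc J)"
      by (induction J) (auto simp: field_simps)
    also have "\<dots> \<le> 2 * a" using Suc.prems by (simp add: field_simps)
    finally show ?thesis using True by simp
  next
    case False
    have "(\<Sum>j<Suc J. if a \<le> c * 2 ^ j then a / 2 ^ j else 0)
        = (\<Sum>j<J. if a \<le> c * 2 ^ Suc j then a / 2 ^ Suc j else 0)"
      unfolding sum.lessThan_Suc_shift using False by simp
    also have "\<dots> = (\<Sum>j<J. if a / 2 \<le> c * 2 ^ j then (a / 2) / 2 ^ j else 0)"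
      by (rule sum.cong) (auto simp: field_simps)
    also have "\<dots> \<le> 2 * c" using Suc.IH[of "a / 2"] Suc.prems by simp
    finally show ?thesis .
  qed
qed

text \<open>At scale j the cutoff is the cube of R = 2^(h 2^j), where log R = h 2^j. A rank k below
  it satisfies k + 2 <= 2 R^3 and hence log (k + 2) <= 4 h 2^j, so
  \<open>sum_geometric_cutoff_le\<close> applies with \<open>c = 4\<close>.\<close>

lemma sum_scales_le:
  assumes h: "1 \<le> h"
  shows "(\<Sum>j<J. displacement_weight f (2 ^ (3 * h * 2 ^ j)) s v / real (h * 2 ^ j)) \<le> 8"
proof (cases v)
  case None
  then show ?thesis by (simp add: displacement_weight_def)
next
  case (Some x)
  define k where "k = probe_rank f x s"
  define a where "a = log 2 (real (k + 2)) / h"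
  have a: "0 \<le> a" by (simp add: a_def)
  have "displacement_weight f (2 ^ (3 * h * 2 ^ j)) s v / real (h * 2 ^ j)
      \<le> (if a \<le> 4 * 2 ^ j then a / 2 ^ j else 0)" for j
  proof (cases "k < 2 ^ (3 * h * 2 ^ j)")
    case True
    have "k + 2 \<le> 2 ^ (1 + 3 * h * 2 ^ j)" using True by simp
    then have "real (k + 2) \<le> 2 ^ (1 + 3 * h * 2 ^ j)"
      by (metis of_nat_le_iff of_nat_numeral of_nat_power)
    then have "log 2 (real (k + 2)) \<le> log 2 (2 ^ (1 + 3 * h * 2 ^ j))"
      by (subst log_le_cancel_iff) auto
    also have "\<dots> = real (1 + 3 * h * 2 ^ j)" by (rule log_pow_cancel) auto
    also have "1 + 3 * h * 2 ^ j \<le> 4 * (h * 2 ^ j)" using h by simp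
    finally have "a \<le> 4 * 2 ^ j" using h by (simp add: a_def field_simps)
    then show ?thesis using True Some by (simp add: displacement_weight_def k_def[symmetric] a_def)
  next
    case False
    then show ?thesis using a Some by (simp add: displacement_weight_def k_def[symmetric])
  qed
  then have "(\<Sum>j<J. displacement_weight f (2 ^ (3 * h * 2 ^ j)) s v / real (h * 2 ^ j))
      \<le> (\<Sum>j<J. if a \<le> 4 * 2 ^ j then a / 2 ^ j else 0)"
    by (rule sum_mono)
  also have "\<dots> \<le> 2 * 4" using a by (rule sum_geometric_cutoff_le) simp
  finally show ?thesis by simp
qed

section \<open>Arrays of a correct table and the weight of an update\<close>

context classical_table
begin

lemma reachable_length: "reachable U N n T \<omega> A \<Longrightarrow> length A = N"
  by (induction rule: reachable.induct) (auto simp: perform_def)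

lemma reachable_once: "reachable U N n T \<omega> A \<Longrightarrow> once A"
  using keys_once reachable_length unfolding once_def by blast

lemma reachable_keys: "reachable U N n T \<omega> A \<Longrightarrow> keys A \<subseteq> {..<U}"
proof (induction rule: reachable.induct)
  case empty
  show ?case by (auto simp: keys_def)
next
  case (step A u \<rho>)
  then show ?case
    using update_correct[OF step(1,2), of \<rho>] by (cases u) auto
qed

text \<open>A correct query for a stored key stops only after seeing it, and the key is stored in
  one slot only, so that slot has been probed.\<close>

lemma probe_rank_less_query_time:
  assumes A: "reachable U N n T \<omega> A" and s: "s < N" "A ! s = Some x"
  shows "probe T \<omega> x (probe_rank (probe T \<omega>) x s) = s" "probe_rank (probe T \<omega>) x s < query_time T \<omega> A x"
proof -
  have x: "x \<in> keys A" using s reachable_length[OF A] by (auto simp: mem_keys_iff)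
  then have xU: "x < U" using reachable_keys[OF A] by auto
  from query_correct[OF A xU] x have "Some x \<in> set (seen T \<omega> A x (query_time T \<omega> A x))"
    by (simp add: query_correct_def)
  then obtain j where j: "j < query_time T \<omega> A x" "A ! probe T \<omega> x j = Some x"
    by (auto simp: seen_def)
  have p: "probe T \<omega> x j = s"
    using keys_once[OF A probe_range[OF xU] s(1) j(2) s(2)] .
  then show "probe T \<omega> x (probe_rank (probe T \<omega>) x s) = s"
    unfolding probe_rank_def by (rule LeastI)
  have "probe_rank (probe T \<omega>) x s \<le> j"
    unfolding probe_rank_def using p by (rule Least_le)
  then show "probe_rank (probe T \<omega>) x s < query_time T \<omega> A x" using j by simp
qed

text \<open>Markov's inequality: a key whose slot has rank at least \<open>R\<close> has query time
  above \<open>R\<close>.\<close>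

lemma card_far_le:
  assumes A: "reachable U N n T \<omega> A"
  shows "R * card {s. s < N \<and> (\<exists>x. A ! s = Some x \<and> R \<le> probe_rank (probe T \<omega>) x s)}
    \<le> (\<Sum>x\<in>keys A. query_time T \<omega> A x)"
proof -
  let ?F = "{s. s < N \<and> (\<exists>x. A ! s = Some x \<and> R \<le> probe_rank (probe T \<omega>) x s)}"
  let ?q = "\<lambda>s. case A ! s of None \<Rightarrow> 0 | Some x \<Rightarrow> query_time T \<omega> A x"
  have "R * card ?F = (\<Sum>s\<in>?F. R)" by simp
  also have "\<dots> \<le> (\<Sum>s\<in>?F. ?q s)"
    by (rule sum_mono) (use probe_rank_less_query_time[OF A] in \<open>fastforce intro: less_imp_le order_le_less_trans\<close>)
  also have "\<dots> \<le> (\<Sum>s<N. ?q s)"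
    by (rule sum_mono2) auto
  also have "\<dots> = (\<Sum>x\<in>keys A. query_time T \<omega> A x)"
    using sum_keys[OF reachable_once[OF A]] reachable_length[OF A] by simp
  finally show ?thesis .
qed

lemma state_after:
  assumes "valid U n {} us" "t \<le> length us"
  shows "reachable U N n T \<omega> (state_after N T \<omega> \<rho> us t)"
    and "keys (state_after N T \<omega> \<rho> us t) = fold apply_operation (take t us) {}"
proof -
  have "reachable U N n T \<omega> (state_after N T \<omega> \<rho> us t) \<and>
      keys (state_after N T \<omega> \<rho> us t) = fold apply_operation (take t us) {}"
    using assms(2)
  proof (induction t)
    case 0
    show ?case by (auto intro: reachable.empty simp: keys_def)
  next
    case (Suc t)
    let ?A = "state_after N T \<omega> \<rho> us t"
    have "us = take t us @ us ! t # drop (Suc t) us"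
      using Suc.prems by (simp add: id_take_nth_drop)
    then have "valid U n {} (take t us @ us ! t # drop (Suc t) us)"
      using assms(1) by simp
    then have app: "applicable U n (keys ?A) (us ! t)"
      using Suc by (simp add: valid_append)
    have "reachable U N n T \<omega> ?A" using Suc by simp
    from reachable.step[OF this app, of "\<rho> t"] update_correct[OF this app, of "\<rho> t"] Suc
    show ?case by (simp add: take_Suc_conv_app_nth)
  qed
  then show "reachable U N n T \<omega> (state_after N T \<omega> \<rho> us t)"
    "keys (state_after N T \<omega> \<rho> us t) = fold apply_operation (take t us) {}" by auto
qed

lemma state_after_take: "t \<le> k \<Longrightarrow> state_after N T \<omega> \<rho> (take k us) t = state_after N T \<omega> \<rho> us t"
  by (induction t) auto

definition step_weight ::
    "bits \<Rightarrow> (nat \<Rightarrow> bits) \<Rightarrow> operation list \<Rightarrow> nat \<Rightarrow> nat \<Rightarrow> real" where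
  "step_weight \<omega> \<rho> us R t = (let A = state_after N T \<omega> \<rho> us t; B = state_after N T \<omega> \<rho> us (Suc t)
     in \<Sum>s\<in>{s. s < N \<and> A ! s \<noteq> B ! s}. displacement_weight (probe T \<omega>) R s (B ! s))"

lemma step_weight_nonneg: "0 \<le> step_weight \<omega> \<rho> us R t"
  by (auto simp: step_weight_def Let_def intro!: sum_nonneg displacement_weight_nonneg)

lemma length_state_after [simp]: "length (state_after N T \<omega> \<rho> us t) = N"
  by (induction t) (auto simp: perform_def)

lemma card_changed_le_update_time:
  "card {s. s < N \<and> state_after N T \<omega> \<rho> us t ! s \<noteq> state_after N T \<omega> \<rho> us (Suc t) ! s}
    \<le> update_time N T \<omega> \<rho> us t"
  using card_changed_le_run[of "state_after N T \<omega> \<rho> us t"]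
  by (simp add: update_time_def perform_def)

text \<open>An update in time 0 leaves the array unchanged, whereas an applicable operation changes
  the key set.\<close>

lemma update_time_pos:
  assumes "valid U n {} us" "t < length us"
  shows "1 \<le> update_time N T \<omega> \<rho> us t"
proof (rule ccontr)
  let ?A = "\<lambda>t. state_after N T \<omega> \<rho> us t"
  assume "\<not> 1 \<le> update_time N T \<omega> \<rho> us t"
  then have "card {s. s < N \<and> ?A t ! s \<noteq> ?A (Suc t) ! s} = 0"
    using card_changed_le_update_time[of \<omega> \<rho> us t] by linarith
  then have eq: "?A (Suc t) = ?A t"
    by (intro nth_equalityI) (auto simp: card_eq_0_iff simp del: state_after.simps)
  have "us = take t us @ us ! t # drop (Suc t) us"
    using assms by (simp add: id_take_nth_drop)
  then have "valid U n {} (take t us @ us ! t # drop (Suc t) us)"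
    using assms(1) by simp
  then have app: "applicable U n (keys (?A t)) (us ! t)"
    using assms state_after(2)[OF assms(1), of t] by (simp add: valid_append)
  moreover have "apply_operation (us ! t) (keys (?A t)) = keys (?A t)"
    using eq update_correct[OF state_after(1)[OF assms(1)] app, of "\<rho> t"] assms(2) by simp
  ultimately show False by (cases "us ! t") auto
qed

text \<open>A slot that differs at the two ends received its final content in the last step that
  changed it, and that step pays its weight.\<close>

lemma changed_weight_le:
  assumes "p \<le> q"
  shows "(\<Sum>s\<in>{s. s < N \<and> state_after N T \<omega> \<rho> us p ! s \<noteq> state_after N T \<omega> \<rho> us q ! s}.
      displacement_weight (probe T \<omega>) R s (state_after N T \<omega> \<rho> us q ! s))
    \<le> (\<Sum>t = p..<q. step_weight \<omega> \<rho> us R t)"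
  using assms
proof (induction q rule: dec_induct)
  case base
  show ?case by simp
next
  case (step q)
  let ?A = "\<lambda>t. state_after N T \<omega> \<rho> us t"
  let ?w = "\<lambda>t s. displacement_weight (probe T \<omega>) R s (?A t ! s)"
  let ?D = "\<lambda>p q. {s. s < N \<and> ?A p ! s \<noteq> ?A q ! s}"
  have "(\<Sum>s\<in>?D p (Suc q). ?w (Suc q) s)
      \<le> (\<Sum>s\<in>?D q (Suc q) \<union> (?D p q - ?D q (Suc q)). ?w (Suc q) s)"
    by (rule sum_mono2) (auto simp: displacement_weight_nonneg)
  also have "\<dots> = (\<Sum>s\<in>?D q (Suc q). ?w (Suc q) s) + (\<Sum>s\<in>?D p q - ?D q (Suc q). ?w (Suc q) s)"
    by (rule sum.union_disjoint) auto
  also have "(\<Sum>s\<in>?D p q - ?D q (Suc q). ?w (Suc q) s) = (\<Sum>s\<in>?D p q - ?D q (Suc q). ?w q s)"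
    by (rule sum.cong) (auto simp del: state_after.simps)
  also have "\<dots> \<le> (\<Sum>s\<in>?D p q. ?w q s)"
    by (rule sum_mono2) (auto simp: displacement_weight_nonneg)
  finally show ?case
    using step.IH step.hyps by (simp add: step_weight_def Let_def del: state_after.simps)
qed

text \<open>The gain of a factor \<open>J\<close>: normalized by \<open>log 2 R\<close>, a changed
  slot is charged at most 8 over all scales together, while each scale separately demands work of
  the same order.\<close>

lemma sum_step_weight_le:
  assumes "1 \<le> h"
  shows "(\<Sum>j<J. step_weight \<omega> \<rho> us (2 ^ (3 * h * 2 ^ j)) t / real (h * 2 ^ j))
    \<le> 8 * real (update_time N T \<omega> \<rho> us t)"
proof -
  let ?A = "\<lambda>t. state_after N T \<omega> \<rho> us t"
  let ?D = "{s. s < N \<and> ?A t ! s \<noteq> ?A (Suc t) ! s}"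
  have "(\<Sum>j<J. step_weight \<omega> \<rho> us (2 ^ (3 * h * 2 ^ j)) t / real (h * 2 ^ j))
    = (\<Sum>s\<in>?D. \<Sum>j<J. displacement_weight (probe T \<omega>) (2 ^ (3 * h * 2 ^ j)) s (?A (Suc t) ! s)
        / real (h * 2 ^ j))"
    unfolding step_weight_def Let_def sum_divide_distrib by (rule sum.swap)
  also have "\<dots> \<le> (\<Sum>s\<in>?D. 8)"
    by (intro sum_mono sum_scales_le assms)
  also have "\<dots> = 8 * real (card ?D)"
    by (simp del: state_after.simps)
  also have "\<dots> \<le> 8 * real (update_time N T \<omega> \<rho> us t)"
    using card_changed_le_update_time by simp
  finally show ?thesis .
qed

end

section \<open>The inequality for one window\<close>

locale churned_table = classical_table +
  assumes two_le: "2 \<le> n" and square_le: "n\<^sup>2 \<le> U"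

sublocale churned_table \<subseteq> churning
proof
  show "1 \<le> n" using two_le by simp
  have "n \<le> n\<^sup>2" by (simp add: power2_eq_square)
  then show "n \<le> U" using square_le by simp
qed

context churned_table
begin

text \<open>The sets reached refer to the array at the end of the prefix \<open>ps\<close>, so they
  are fixed before the window \<open>vs\<close> is drawn.\<close>

definition window_cost ::
    "bits \<Rightarrow> (nat \<Rightarrow> bits) \<Rightarrow> nat \<Rightarrow> operation list \<Rightarrow> operation list \<Rightarrow> nat" where
  "window_cost \<omega> \<rho> R ps vs = (let A = state_after N T \<omega> \<rho> ps (length ps)
     in churn_cost (reach (probe T \<omega>) A R) (keys A) {} {} vs)"

definition total_query_time ::
    "bits \<Rightarrow> (nat \<Rightarrow> bits) \<Rightarrow> operation list \<Rightarrow> nat \<Rightarrow> nat" where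
  "total_query_time \<omega> \<rho> us r = (let A = state_after N T \<omega> \<rho> us (n + 2 * r)
     in \<Sum>x\<in>keys A. query_time T \<omega> A x)"

text \<open>\<open>log_new_keys_le\<close> for the arrays at both ends, with
  \<open>churn_cost_ge\<close> bounding the number of new keys from below by \<open>m\<close> plus
  the hits minus the cost. The new keys that reach a deleted one occur in both inequalities and
  cancel.\<close>

lemma window_bound:
  assumes us: "us \<in> set_pmf (workload U n)" and rm: "r + m \<le> n\<^sup>2" and R: "1 \<le> R" and L: "1 \<le> L"
  shows "m * log 2 R \<le> (\<Sum>t = n + 2 * r..<n + 2 * (r + m). step_weight \<omega> \<rho> us L t)
    + log 2 R * (window_cost \<omega> \<rho> R (take (n + 2 * r) us) (take (2 * m) (drop (n + 2 * r) us))
      + (real N - n) + total_query_time \<omega> \<rho> us (r + m) / L)"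
proof -
  define p where "p = n + 2 * r"
  define q where "q = n + 2 * (r + m)"
  define vs where "vs = take (2 * m) (drop p us)"
  define A where "A = state_after N T \<omega> \<rho> us p"
  define B where "B = state_after N T \<omega> \<rho> us q"
  define h where "h = probe T \<omega>"
  have len: "length us = n + 2 * n\<^sup>2" and valid: "valid U n {} us"
    using prefix_workload_support[of us "n\<^sup>2"] us by (auto simp: workload_eq)
  have pq: "p \<le> q" "q \<le> length us" using rm len by (auto simp: p_def q_def)
  note supp = workload_window_support[OF rm us, folded p_def, folded vs_def]
  have keysA: "keys A = fold apply_operation (take p us) {}"
    unfolding A_def using state_after(2)[OF valid] pq by simp
  have fullA: "full (keys A)"
    using prefix_workload_support(3)[OF supp(1)] by (simp add: keysA)
  have "take q us = take p us @ vs"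
    unfolding vs_def take_add[symmetric] by (simp add: p_def q_def algebra_simps)
  then have keysB: "keys B = fold apply_operation vs (keys A)"
    unfolding B_def keysA using state_after(2)[OF valid pq(2)] by simp
  note vs = churn_support[OF fullA supp(2)[folded keysA]]
  have reach: "reachable U N n T \<omega> A" "reachable U N n T \<omega> B"
    unfolding A_def B_def using state_after(1)[OF valid] pq by auto
  have [simp]: "length A = N" "length B = N" by (auto simp: A_def B_def)
  note once = reach[THEN reachable_once]
  let ?Y = "keys B - keys A" and ?X = "keys A - keys B"
  let ?hit = "{y \<in> ?Y. reach h A R y \<inter> ?X \<noteq> {}}"
  let ?free = "{s. s < N \<and> A ! s = None}"
  let ?far = "{s. s < N \<and> (\<exists>x. B ! s = Some x \<and> L \<le> probe_rank h x s)}"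
  let ?cost = "window_cost \<omega> \<rho> R (take p us) vs"
  have main: "log 2 R * card ?Y \<le>
      (\<Sum>s\<in>{s. s < length A \<and> A ! s \<noteq> B ! s}. displacement_weight h L s (B ! s))
      + log 2 R * (card ?hit + card {s. s < length A \<and> A ! s = None}
        + card {s. s < length A \<and> (\<exists>x. B ! s = Some x \<and> L \<le> probe_rank h x s)})"
    by (rule log_new_keys_le)
       (use once R probe_rank_less_query_time(1)[OF reach(2)] in \<open>auto simp: h_def\<close>)
  have weight: "(\<Sum>s\<in>{s. s < length A \<and> A ! s \<noteq> B ! s}. displacement_weight h L s (B ! s))
      \<le> (\<Sum>t = p..<q. step_weight \<omega> \<rho> us L t)"
    using changed_weight_le[OF pq(1)] by (simp add: A_def B_def h_def)
  have "card {i. i < length vs \<and> (\<exists>y. vs ! i = Insert y)} + card ?hit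
      \<le> card ?Y + churn_cost (reach h A R) (keys A) {} {} vs"
    unfolding keysB by (rule churn_cost_ge[OF vs(2) full_finite[OF fullA]])
  moreover have "state_after N T \<omega> \<rho> (take p us) (length (take p us)) = A"
    using pq by (simp add: A_def state_after_take)
  ultimately have Y: "m + card ?hit \<le> card ?Y + ?cost"
    unfolding vs(4) by (simp add: window_cost_def h_def card_image inj_on_def)
  have free: "real (card ?free) = real N - n"
    using card_free[OF once(1)] fullA by (simp add: full_def)
  have "L * card ?far \<le> total_query_time \<omega> \<rho> us (r + m)"
    using card_far_le[OF reach(2), of L] by (simp add: total_query_time_def B_def h_def q_def Let_def)
  then have "real (L * card ?far) \<le> real (total_query_time \<omega> \<rho> us (r + m))"
    by (rule of_nat_mono)
  then have far: "real (card ?far) \<le> total_query_time \<omega> \<rho> us (r + m) / L"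
    using L by (simp add: field_simps)
  have "m * log 2 R = log 2 R * m" by simp
  also have "\<dots> \<le> log 2 R * (real (card ?Y) + ?cost - card ?hit)"
  proof (rule mult_left_mono)
    show "real m \<le> real (card ?Y) + ?cost - card ?hit" using Y by linarith
    show "0 \<le> log 2 (real R)" using R by simp
  qed
  also have "\<dots> = log 2 R * card ?Y + log 2 R * (real ?cost - card ?hit)"
    by (simp add: algebra_simps)
  also have "\<dots> \<le> (\<Sum>t = p..<q. step_weight \<omega> \<rho> us L t)
      + log 2 R * (card ?hit + card ?free + card ?far) + log 2 R * (real ?cost - card ?hit)"
    using main weight by simp
  also have "\<dots> = (\<Sum>t = p..<q. step_weight \<omega> \<rho> us L t) + log 2 R * (?cost + (real N - n) + card ?far)"
    by (simp add: free algebra_simps)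
  also have "\<dots> \<le> (\<Sum>t = p..<q. step_weight \<omega> \<rho> us L t)
      + log 2 R * (?cost + (real N - n) + total_query_time \<omega> \<rho> us (r + m) / L)"
    using far R by (intro add_left_mono mult_left_mono) auto
  finally show ?thesis
    unfolding p_def q_def vs_def .
qed

lemma expectation_window_cost_le:
  assumes "r + m \<le> n\<^sup>2" "1 \<le> R" "1 \<le> m" "48 * m * R\<^sup>2 \<le> n"
  shows "measure_pmf.expectation (workload U n) (\<lambda>us.
      real (window_cost \<omega> \<rho> R (take (n + 2 * r) us) (take (2 * m) (drop (n + 2 * r) us)))) \<le> m / 8"
proof (rule expectation_window_le[OF assms(1)])
  fix ps assume ps: "ps \<in> set_pmf (prefix_workload r)"
  note supp = prefix_workload_support[OF ps]
  have keys: "keys (state_after N T \<omega> \<rho> ps (length ps)) = fold apply_operation ps {}"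
    using state_after(2)[OF supp(2), of "length ps"] by simp
  show "measure_pmf.expectation (churn U m (fold apply_operation ps {}))
      (\<lambda>vs. real (window_cost \<omega> \<rho> R ps vs)) \<le> m / 8"
    unfolding window_cost_def Let_def keys
    by (rule expectation_churn_cost_from_start_le[where g = "R\<^sup>2"])
       (use supp two_le square_le assms reach_finite_card in auto)
qed

end

section \<open>Averaging over windows and summing over scales\<close>

context churned_table
begin

abbreviation E :: "(operation list \<Rightarrow> real) \<Rightarrow> real" where
  "E \<equiv> measure_pmf.expectation (workload U n)"

lemma finite_workload: "finite (set_pmf (workload U n))"
  unfolding workload_eq by (rule finite_prefix_workload)

lemma integrable_workload [simp, intro]: "integrable (workload U n) (f :: _ \<Rightarrow> real)"
  by (rule integrable_measure_pmf_finite[OF finite_workload])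

text \<open>\<open>window_bound\<close> summed over all starting rounds, for fixed random bits.
  Window costs and free slots each consume at most an eighth of the demand, leaving 3/4; as 2 m <=
  n^2, there are at least n^2 / 2 windows, which gives 3/8.\<close>

lemma scale_bound:
  assumes m: "1 \<le> m" "48 * m * R\<^sup>2 \<le> n" and R: "2 \<le> R" and L: "1 \<le> L"
    and free: "8 * (real N - n) \<le> m"
  shows "3 / 8 * real (n\<^sup>2) \<le> E (\<lambda>us. \<Sum>t = n..<n + 2 * n\<^sup>2. step_weight \<omega> \<rho> us L t) / log 2 R
    + E (\<lambda>us. \<Sum>r = 1..n\<^sup>2. real (total_query_time \<omega> \<rho> us r)) / (real m * L)"
proof -
  define K where "K = n\<^sup>2"
  define W where "W = real (Suc (K - m))"
  define \<Lambda> where "\<Lambda> = log 2 R"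
  have \<Lambda>: "0 < \<Lambda>" using R by (simp add: \<Lambda>_def)
  have W: "0 < W" by (simp add: W_def)
  have "48 * m * 1 \<le> 48 * m * R\<^sup>2" using R by (intro mult_le_mono2) simp
  then have "48 * m \<le> n" using m(2) by linarith
  moreover have "n \<le> K" by (simp add: K_def power2_eq_square)
  ultimately have mK: "2 * m \<le> K" by linarith
  then have WK: "real K / 2 \<le> W" by (simp add: W_def of_nat_diff)
  define SW where "SW us = (\<Sum>t = n..<n + 2 * K. step_weight \<omega> \<rho> us L t)" for us
  define TQ where "TQ us = (\<Sum>r = 1..K. real (total_query_time \<omega> \<rho> us r))" for us
  define wc where "wc r us =
    real (window_cost \<omega> \<rho> R (take (n + 2 * r) us) (take (2 * m) (drop (n + 2 * r) us)))" for r us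
  have "m * \<Lambda> * W \<le> m * SW us + \<Lambda> * ((\<Sum>r\<le>K - m. wc r us) + W * (real N - n) + TQ us / L)"
    if us: "us \<in> set_pmf (workload U n)" for us
  proof -
    have "m * \<Lambda> * W = (\<Sum>r\<le>K - m. m * log 2 R)"
      by (simp add: W_def \<Lambda>_def)
    also have "\<dots> \<le> (\<Sum>r\<le>K - m. (\<Sum>t = n + 2 * r..<n + 2 * (r + m). step_weight \<omega> \<rho> us L t)
        + \<Lambda> * (wc r us + (real N - n) + total_query_time \<omega> \<rho> us (r + m) / L))"
      unfolding wc_def \<Lambda>_def
      by (intro sum_mono window_bound us L) (use R mK in \<open>auto simp: K_def\<close>)
    also have "\<dots> = (\<Sum>r\<le>K - m. \<Sum>t = n + 2 * r..<n + 2 * (r + m). step_weight \<omega> \<rho> us L t)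
        + \<Lambda> * ((\<Sum>r\<le>K - m. wc r us) + W * (real N - n)
          + (\<Sum>r\<le>K - m. real (total_query_time \<omega> \<rho> us (r + m))) / L)"
      by (simp add: sum.distrib sum_distrib_left[symmetric] sum_divide_distrib W_def)
    also have "\<dots> \<le> m * SW us + \<Lambda> * ((\<Sum>r\<le>K - m. wc r us) + W * (real N - n) + TQ us / L)"
    proof (intro add_mono mult_left_mono divide_right_mono order_refl)
      show "(\<Sum>r\<le>K - m. \<Sum>t = n + 2 * r..<n + 2 * (r + m). step_weight \<omega> \<rho> us L t) \<le> m * SW us"
        unfolding SW_def by (rule sum_windows_le) (use step_weight_nonneg mK in auto)
      have "(\<Sum>r\<le>K - m. real (total_query_time \<omega> \<rho> us (r + m)))
          = (\<Sum>r\<in>(\<lambda>r. r + m) ` {..K - m}. real (total_query_time \<omega> \<rho> us r))"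
        by (subst sum.reindex) auto
      also have "\<dots> \<le> TQ us"
        unfolding TQ_def by (rule sum_mono2) (use m mK in auto)
      finally show "(\<Sum>r\<le>K - m. real (total_query_time \<omega> \<rho> us (r + m))) \<le> TQ us" .
    qed (use \<Lambda> W in auto)
    finally show ?thesis .
  qed
  then have "E (\<lambda>us. m * \<Lambda> * W)
      \<le> E (\<lambda>us. m * SW us + \<Lambda> * ((\<Sum>r\<le>K - m. wc r us) + W * (real N - n) + TQ us / L))"
    by (intro finite_expectation_mono finite_workload)
  also have "\<dots> = m * E SW + \<Lambda> * ((\<Sum>r\<le>K - m. E (wc r)) + W * (real N - n) + E TQ / L)"
    by simp
  also have "\<dots> \<le> m * E SW + \<Lambda> * ((\<Sum>r\<le>K - m. m / 8) + W * (m / 8) + E TQ / L)"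
  proof (intro add_mono mult_left_mono sum_mono order_refl)
    fix r assume "r \<in> {..K - m}"
    then show "E (wc r) \<le> real m / 8"
      unfolding wc_def by (intro expectation_window_cost_le) (use R m mK in \<open>auto simp: K_def\<close>)
  qed (use \<Lambda> W free in auto)
  also have "\<dots> = m * E SW + \<Lambda> * (W * m / 4 + E TQ / L)"
    by (simp add: W_def)
  also have "\<dots> = m * E SW + W * (m * \<Lambda>) / 4 + \<Lambda> * E TQ / L"
    by (simp add: algebra_simps)
  also have "E (\<lambda>us. m * \<Lambda> * W) = W * (m * \<Lambda>)"
    by simp
  finally have "3 / 4 * W * (m * \<Lambda>) \<le> m * E SW + \<Lambda> * E TQ / L"
    by linarith
  then have "3 / 4 * W \<le> (m * E SW + \<Lambda> * E TQ / L) / (m * \<Lambda>)"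
    using m \<Lambda> by (subst pos_le_divide_eq) auto
  also have "\<dots> = E SW / \<Lambda> + E TQ / (real m * L)"
    using m \<Lambda> L by (simp add: field_simps)
  finally show ?thesis
    using WK unfolding SW_def TQ_def \<Lambda>_def K_def[symmetric] by linarith
qed

text \<open>\<open>scale_bound\<close> for all scales added up. Each scale j uses its own window
  length of order n / R^2 for R = 2^(h 2^j).\<close>

lemma all_scales_bound:
  fixes Q :: real and h J :: nat
  assumes h: "1 \<le> h" and Q: "0 < Q" "1024 * Q \<le> 2 ^ h"
    and small: "\<And>j. j < J \<Longrightarrow> 64 * (2 ^ (h * 2 ^ j))\<^sup>2 \<le> n"
      "\<And>j. j < J \<Longrightarrow> 1024 * (2 ^ (h * 2 ^ j))\<^sup>2 * (real N - n) \<le> n"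
  shows "3 / 8 * real (n\<^sup>2) * J \<le> 8 * E (\<lambda>us. \<Sum>t = n..<n + 2 * n\<^sup>2. real (update_time N T \<omega> \<rho> us t))
    + J * (E (\<lambda>us. \<Sum>r = 1..n\<^sup>2. real (total_query_time \<omega> \<rho> us r)) / (8 * Q * n))"
proof -
  define TQ where "TQ us = (\<Sum>r = 1..n\<^sup>2. real (total_query_time \<omega> \<rho> us r))" for us
  define L :: "nat \<Rightarrow> nat" where "L j = 2 ^ (3 * h * 2 ^ j)" for j
  define SW where "SW j us = (\<Sum>t = n..<n + 2 * n\<^sup>2. step_weight \<omega> \<rho> us (L j) t)" for j us
  have n: "0 < real n" using n_pos by simp
  have TQ: "0 \<le> E TQ"
    by (rule Bochner_Integration.integral_nonneg) (auto simp: TQ_def intro: sum_nonneg)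
  have scale: "3 / 8 * real (n\<^sup>2) \<le> E (SW j) / (h * 2 ^ j) + E TQ / (8 * Q * n)" if j: "j < J" for j
  proof -
    define R :: nat where "R = 2 ^ (h * 2 ^ j)"
    \<comment> \<open>The divisor 64 ensures 48 m R^2 <= n. Rounding down loses at most a factor 2,
      so m >= n / (128 R^2), which by the second smallness condition is at least 8 (N - n).\<close>
    define m where "m = n div (64 * R\<^sup>2)"
    have "2 ^ 1 \<le> R" unfolding R_def using h by (intro power_increasing) auto
    then have R: "2 \<le> R" by simp
    have n64: "64 * R\<^sup>2 \<le> n" using small(1)[OF j] by (simp add: R_def)
    then have "64 * R\<^sup>2 div (64 * R\<^sup>2) \<le> m"
      unfolding m_def by (rule div_le_mono)
    then have m1: "1 \<le> m" using R by simp
    have mR: "m * (64 * R\<^sup>2) \<le> n" unfolding m_def by (rule div_times_less_eq_dividend)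
    have "n < (m + 1) * (64 * R\<^sup>2)"
      unfolding m_def using R dividend_less_div_times[of "64 * R\<^sup>2" n] by simp
    also have "\<dots> \<le> (2 * m) * (64 * R\<^sup>2)" using m1 by (intro mult_le_mono1) simp
    finally have "n \<le> 128 * R\<^sup>2 * m" by (simp add: mult_ac)
    then have "real n \<le> real (128 * R\<^sup>2 * m)" by (rule of_nat_mono)
    then have nm: "real n \<le> 128 * (real R)\<^sup>2 * m" by simp
    have "1024 * (real R)\<^sup>2 * (real N - n) \<le> real n"
      using small(2)[OF j] by (simp only: R_def of_nat_power of_nat_numeral)
    then have "(128 * (real R)\<^sup>2) * (8 * (real N - n)) \<le> (128 * (real R)\<^sup>2) * m"
      using nm by linarith
    then have free: "8 * (real N - n) \<le> m"
      by (rule mult_left_le_imp_le) (use R in simp)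
    have "48 * m * R\<^sup>2 \<le> n" using mR by simp
    from scale_bound[OF m1 this R _ free, of "L j" \<omega> \<rho>]
    have "3 / 8 * real (n\<^sup>2) \<le> E (SW j) / log 2 R + E TQ / (real m * L j)"
      by (simp add: SW_def[abs_def] TQ_def[abs_def] L_def)
    also have "log 2 R = h * 2 ^ j" by (simp add: R_def log_nat_power)
    \<comment> \<open>With L = R^3 and R >= 1024 Q, m L >= n R / 128 >= 8 Q n. The third power
      compensates for the window length n / R^2 and leaves one factor R to beat the query
      time.\<close>
    also have "E TQ / (real m * L j) \<le> E TQ / (8 * Q * n)"
    proof (rule divide_left_mono)
      have "(2::real) ^ h \<le> 2 ^ (h * 2 ^ j)" by (intro power_increasing) auto
      then have "1024 * Q \<le> 2 ^ (h * 2 ^ j)" using Q(2) by linarith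
      then have "1024 * Q \<le> R" by (simp only: R_def of_nat_power of_nat_numeral)
      then have "8 * Q * n \<le> R / 128 * n" by (intro mult_right_mono) linarith+
      also have "\<dots> \<le> R / 128 * (128 * (real R)\<^sup>2 * m)" by (rule mult_left_mono[OF nm]) simp
      also have "\<dots> = real m * real (R ^ 3)" by (simp add: power2_eq_square power3_eq_cube)
      also have "R ^ 3 = L j"
        unfolding R_def L_def power_mult[symmetric] by (rule arg_cong[where f = "(^) 2"]) simp
      finally show "8 * Q * n \<le> real m * L j" .
    qed (use TQ Q n m1 in \<open>auto simp: L_def\<close>)
    finally show ?thesis by simp
  qed
  have "3 / 8 * real (n\<^sup>2) * J = (\<Sum>j<J. 3 / 8 * real (n\<^sup>2))" by simp
  also have "\<dots> \<le> (\<Sum>j<J. E (SW j) / (h * 2 ^ j) + E TQ / (8 * Q * n))"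
    by (rule sum_mono) (use scale in auto)
  also have "\<dots> = E (\<lambda>us. \<Sum>j<J. SW j us / (h * 2 ^ j)) + J * (E TQ / (8 * Q * n))"
    by (simp add: sum.distrib)
  also have "E (\<lambda>us. \<Sum>j<J. SW j us / (h * 2 ^ j))
      \<le> E (\<lambda>us. 8 * (\<Sum>t = n..<n + 2 * n\<^sup>2. real (update_time N T \<omega> \<rho> us t)))"
  proof (rule finite_expectation_mono[OF finite_workload])
    fix us
    have "(\<Sum>j<J. SW j us / (h * 2 ^ j))
        = (\<Sum>t = n..<n + 2 * n\<^sup>2. \<Sum>j<J. step_weight \<omega> \<rho> us (L j) t / real (h * 2 ^ j))"
      unfolding SW_def sum_divide_distrib by (subst sum.swap) simp
    also have "\<dots> \<le> (\<Sum>t = n..<n + 2 * n\<^sup>2. 8 * real (update_time N T \<omega> \<rho> us t))"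
      unfolding L_def by (intro sum_mono sum_step_weight_le h)
    finally show "(\<Sum>j<J. SW j us / (h * 2 ^ j))
        \<le> 8 * (\<Sum>t = n..<n + 2 * n\<^sup>2. real (update_time N T \<omega> \<rho> us t))"
      by (simp add: sum_distrib_left)
  qed
  finally show ?thesis by (simp add: TQ_def[abs_def])
qed

end

section \<open>Measurability and integration over the random bits\<close>

text \<open>Operation sequences thus form a countable type, so \<open>measurable_outcomes\<close>
  can treat them one at a time.\<close>

instance operation :: countable
  by countable_datatype

lemma prob_space_random_bits: "prob_space random_bits"
  unfolding random_bits_def by (intro prob_space_PiM measure_pmf.prob_space_axioms)

lemma (in classical_table) measurable_seen:
  "(\<lambda>\<omega>. seen T \<omega> A x i) \<in> measurable random_bits (count_space UNIV)"
proof (induction i)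
  case 0
  show ?case by (simp add: seen_def)
next
  case (Suc i)
  have "(\<lambda>\<omega>. seen T \<omega> A x i @ [A ! probe T \<omega> x i]) \<in> measurable random_bits (count_space UNIV)"
    using Suc
    by (rule measurable_compose_countable[rotated])
       (rule measurable_compose_countable[rotated, OF measurable_probe], simp)
  then show ?case by (simp add: seen_def)
qed

lemma (in classical_table) measurable_query_time:
  "(\<lambda>\<omega>. query_time T \<omega> A x) \<in> measurable random_bits (count_space UNIV)"
  unfolding query_time_def
proof (rule measurable_Least)
  fix i
  have "(\<lambda>\<omega>. Some x \<in> set (seen T \<omega> A x i) \<or>
      gives_up T \<omega> x (card (keys A)) (seen T \<omega> A x i)) \<in> measurable random_bits (count_space UNIV)"
  proof (rule measurable_compose_countable[OF _ measurable_seen])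
    fix vs
    note [measurable] = measurable_gives_up[of x "card (keys A)" vs]
    show "(\<lambda>\<omega>. Some x \<in> set vs \<or> gives_up T \<omega> x (card (keys A)) vs)
        \<in> measurable random_bits (count_space UNIV)"
      by measurable
  qed
  then show "(\<lambda>\<omega>. query_stops T \<omega> A x i) \<in> measurable random_bits (count_space UNIV)"
    by (simp add: query_stops_def)
qed

abbreviation bits_pair :: "(bits \<times> (nat \<Rightarrow> bits)) measure" where
  "bits_pair \<equiv> random_bits \<Otimes>\<^sub>M PiM UNIV (\<lambda>_. random_bits)"

lemma (in classical_table) measurable_perform_after:
  assumes "(\<lambda>x. A (fst x) (snd x)) \<in> measurable bits_pair (count_space UNIV)"
  shows "(\<lambda>x. perform T (fst x) (snd x t) (A (fst x) (snd x)) u)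
    \<in> measurable bits_pair (count_space UNIV)"
proof (rule measurable_compose_countable[OF _ assms])
  fix B
  have "(\<lambda>x. (fst x, snd x t)) \<in> measurable bits_pair (random_bits \<Otimes>\<^sub>M random_bits)"
    by measurable
  from measurable_compose[OF this measurable_perform[of B u]]
  show "(\<lambda>x. perform T (fst x) (snd x t) B u) \<in> measurable bits_pair (count_space UNIV)"
    by simp
qed

lemma (in classical_table) measurable_state_after:
  "(\<lambda>x. state_after N T (fst x) (snd x) us t) \<in> measurable bits_pair (count_space UNIV)"
proof (induction t)
  case (Suc t)
  from measurable_compose[OF measurable_perform_after[OF this, of t "us ! t"], of fst]
  show ?case by simp
qed simp

lemma (in classical_table) measurable_update_time:
  "(\<lambda>x. update_time N T (fst x) (snd x) us t) \<in> measurable bits_pair (count_space UNIV)"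
  unfolding update_time_def
  using measurable_compose[OF measurable_perform_after[
      where A = "\<lambda>\<omega> \<rho>. state_after N T \<omega> \<rho> us t" and t = t and u = "us ! t",
      OF measurable_state_after], of snd]
  by simp

lemma measurable_outcomes:
  assumes "\<And>us. (\<lambda>x. f us (fst x) (snd x)) \<in> borel_measurable bits_pair"
  shows "(\<lambda>(\<omega>, \<rho>, us). f us \<omega> \<rho> :: ennreal) \<in> borel_measurable (outcomes U n)"
proof -
  let ?M = "outcomes U n"
  have "(\<lambda>x. snd (snd x)) \<in> measurable ?M (measure_pmf (workload U n))"
    unfolding outcomes_def by measurable
  then have ops: "(\<lambda>x. snd (snd x)) \<in> measurable ?M (count_space UNIV)"
    by simp
  have "(\<lambda>x. f (snd (snd x)) (fst x) (fst (snd x))) \<in> borel_measurable ?M"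
  proof (rule measurable_compose_countable[OF _ ops])
    fix us
    have "(\<lambda>x. (fst x, fst (snd x))) \<in> measurable ?M bits_pair"
      unfolding outcomes_def by measurable
    from measurable_compose[OF this assms[of us]]
    show "(\<lambda>x. f us (fst x) (fst (snd x))) \<in> borel_measurable ?M"
      by simp
  qed
  then show ?thesis by (simp add: case_prod_beta)
qed

text \<open>A lower bound for the workload average that holds for every outcome of the random bits
  survives averaging over the bits, by Tonelli and since both measures of bits are probability
  measures.\<close>

lemma const_le_nn_integral_outcomes:
  fixes f :: "operation list \<Rightarrow> bits \<Rightarrow> (nat \<Rightarrow> bits) \<Rightarrow> ennreal"
  assumes meas: "\<And>us. (\<lambda>x. f us (fst x) (snd x)) \<in> borel_measurable bits_pair"
    and le: "\<And>\<omega> \<rho>. c \<le> (\<integral>\<^sup>+us. f us \<omega> \<rho> \<partial>measure_pmf (workload U n))"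
  shows "c \<le> (\<integral>\<^sup>+(\<omega>, \<rho>, us). f us \<omega> \<rho> \<partial>outcomes U n)"
proof -
  let ?W = "measure_pmf (workload U n)"
  let ?P = "PiM UNIV (\<lambda>_. random_bits) :: (nat \<Rightarrow> bits) measure"
  interpret R: prob_space random_bits by (rule prob_space_random_bits)
  interpret P: prob_space ?P by (intro prob_space_PiM prob_space_random_bits)
  interpret PW: pair_prob_space ?P ?W ..
  have m: "(\<lambda>(\<omega>, \<rho>, us). f us \<omega> \<rho>) \<in> borel_measurable (random_bits \<Otimes>\<^sub>M (?P \<Otimes>\<^sub>M ?W))"
    using measurable_outcomes[OF meas] by (simp add: outcomes_def)
  have "c = (\<integral>\<^sup>+\<omega>. \<integral>\<^sup>+\<rho>. c \<partial>?P \<partial>random_bits)"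
    by (simp add: R.emeasure_space_1 P.emeasure_space_1)
  also have "\<dots> \<le> (\<integral>\<^sup>+\<omega>. \<integral>\<^sup>+\<rho>. \<integral>\<^sup>+us. f us \<omega> \<rho> \<partial>?W \<partial>?P \<partial>random_bits)"
    by (intro nn_integral_mono le)
  also have "\<dots> = (\<integral>\<^sup>+\<omega>. \<integral>\<^sup>+y. f (snd y) \<omega> (fst y) \<partial>(?P \<Otimes>\<^sub>M ?W) \<partial>random_bits)"
  proof (rule nn_integral_cong)
    fix \<omega> assume "\<omega> \<in> space random_bits"
    then have "(\<lambda>y. f (snd y) \<omega> (fst y)) \<in> borel_measurable (?P \<Otimes>\<^sub>M ?W)"
      using measurable_compose[OF measurable_Pair1' m] by (simp add: case_prod_beta)
    from measure_pmf.nn_integral_fst[OF this]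
    show "(\<integral>\<^sup>+\<rho>. \<integral>\<^sup>+us. f us \<omega> \<rho> \<partial>?W \<partial>?P) = (\<integral>\<^sup>+y. f (snd y) \<omega> (fst y) \<partial>(?P \<Otimes>\<^sub>M ?W))"
      by simp
  qed
  also have "\<dots> = (\<integral>\<^sup>+(\<omega>, \<rho>, us). f us \<omega> \<rho> \<partial>outcomes U n)"
    using PW.nn_integral_fst[OF m] by (simp add: outcomes_def case_prod_beta)
  finally show ?thesis .
qed

section \<open>The expected times as integrals\<close>

definition update_sum ::
    "nat \<Rightarrow> nat \<Rightarrow> table \<Rightarrow> operation list \<Rightarrow> bits \<Rightarrow> (nat \<Rightarrow> bits) \<Rightarrow> ennreal" where
  "update_sum N n T us \<omega> \<rho> = (\<Sum>t = n..<n + 2 * n\<^sup>2. of_nat (update_time N T \<omega> \<rho> us t))"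

definition query_sum ::
    "nat \<Rightarrow> nat \<Rightarrow> table \<Rightarrow> operation list \<Rightarrow> bits \<Rightarrow> (nat \<Rightarrow> bits) \<Rightarrow> ennreal" where
  "query_sum N n T us \<omega> \<rho> = (\<Sum>r = 1..n\<^sup>2.
     let A = state_after N T \<omega> \<rho> us (n + 2 * r)
     in (\<Sum>x\<in>keys A. of_nat (query_time T \<omega> A x)) / of_nat (card (keys A)))"

lemma (in classical_table) measurable_update_sum:
  "(\<lambda>x. update_sum N n T us (fst x) (snd x)) \<in> borel_measurable bits_pair"
  unfolding update_sum_def
  by (intro borel_measurable_sum measurable_compose[OF measurable_update_time]) simp

lemma (in classical_table) measurable_query_sum:
  "(\<lambda>x. query_sum N n T us (fst x) (snd x)) \<in> borel_measurable bits_pair"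
  unfolding query_sum_def Let_def
proof (rule borel_measurable_sum)
  fix r
  show "(\<lambda>x. (\<Sum>k\<in>keys (state_after N T (fst x) (snd x) us (n + 2 * r)).
        of_nat (query_time T (fst x) (state_after N T (fst x) (snd x) us (n + 2 * r)) k))
      / of_nat (card (keys (state_after N T (fst x) (snd x) us (n + 2 * r)))) :: ennreal)
    \<in> borel_measurable bits_pair"
  proof (rule measurable_compose_countable[OF _ measurable_state_after])
    fix A
    have [measurable]: "(\<lambda>x. of_nat (query_time T (fst x) A k) :: ennreal) \<in> borel_measurable bits_pair" for k
      by (rule measurable_compose[OF measurable_compose[OF measurable_fst measurable_query_time]]) simp
    show "(\<lambda>x. (\<Sum>k\<in>keys A. of_nat (query_time T (fst x) A k)) / of_nat (card (keys A)) :: ennreal)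
        \<in> borel_measurable bits_pair"
      by measurable
  qed
qed

lemma expected_update_time_eq:
  "expected_update_time U N n T
    = (\<integral>\<^sup>+(\<omega>, \<rho>, us). update_sum N n T us \<omega> \<rho> \<partial>outcomes U n) / of_nat (2 * n\<^sup>2)"
  by (simp add: expected_update_time_def update_sum_def)

lemma expected_query_time_eq:
  "expected_query_time U N n T
    = (\<integral>\<^sup>+(\<omega>, \<rho>, us). query_sum N n T us \<omega> \<rho> \<partial>outcomes U n) / of_nat (n\<^sup>2)"
  by (simp add: expected_query_time_def query_sum_def)

context churned_table
begin

text \<open>Exactly \<open>n\<close> keys are stored after each round, so the average over the
  stored keys divides by a constant.\<close>

lemma query_sum_eq:
  assumes us: "us \<in> set_pmf (workload U n)"
  shows "query_sum N n T us \<omega> \<rho> = ennreal ((\<Sum>r = 1..n\<^sup>2. real (total_query_time \<omega> \<rho> us r)) / n)"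
proof -
  have n: "0 < real n" using n_pos by simp
  have len: "length us = n + 2 * n\<^sup>2" and valid: "valid U n {} us"
    using prefix_workload_support[of us "n\<^sup>2"] us by (auto simp: workload_eq)
  have "card (keys (state_after N T \<omega> \<rho> us (n + 2 * r))) = n" if "r \<le> n\<^sup>2" for r
  proof -
    have "take (n + 2 * r) us \<in> set_pmf (prefix_workload r)"
      using workload_window_support(1)[of r 0 us] us that by simp
    then show ?thesis
      using prefix_workload_support(3) state_after(2)[OF valid, of "n + 2 * r"] that len
      by (simp add: full_def)
  qed
  then have "query_sum N n T us \<omega> \<rho> = (\<Sum>r = 1..n\<^sup>2. ennreal (real (total_query_time \<omega> \<rho> us r) / n))"
    unfolding query_sum_def Let_def using n
    by (intro sum.cong)
       (auto simp: total_query_time_def Let_def divide_ennreal[symmetric] ennreal_of_nat_eq_real_of_nat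
          simp flip: of_nat_sum)
  then show ?thesis
    by (simp add: sum_divide_distrib)
qed

text \<open>Covers the range in which \<epsilon> is bounded away from 0 and the claimed bound is a
  constant.\<close>

lemma expected_update_time_ge_one: "1 \<le> expected_update_time U N n T"
proof -
  have n: "0 < real n" using n_pos by simp
  have "ennreal (real (2 * n\<^sup>2)) \<le> (\<integral>\<^sup>+(\<omega>, \<rho>, us). update_sum N n T us \<omega> \<rho> \<partial>outcomes U n)"
  proof (rule const_le_nn_integral_outcomes[OF measurable_update_sum])
    fix \<omega> \<rho>
    have le: "ennreal (real (2 * n\<^sup>2)) \<le> update_sum N n T us \<omega> \<rho>" if "us \<in> set_pmf (workload U n)" for us
    proof -
      have len: "length us = n + 2 * n\<^sup>2" and valid: "valid U n {} us"
        using prefix_workload_support[of us "n\<^sup>2"] that by (auto simp: workload_eq)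
      have "(\<Sum>t = n..<n + 2 * n\<^sup>2. 1) \<le> (\<Sum>t = n..<n + 2 * n\<^sup>2. update_time N T \<omega> \<rho> us t)"
        by (intro sum_mono update_time_pos[OF valid]) (simp add: len)
      then have "2 * n\<^sup>2 \<le> (\<Sum>t = n..<n + 2 * n\<^sup>2. update_time N T \<omega> \<rho> us t)" by simp
      then have "(of_nat (2 * n\<^sup>2) :: ennreal) \<le> of_nat (\<Sum>t = n..<n + 2 * n\<^sup>2. update_time N T \<omega> \<rho> us t)"
        by (rule of_nat_mono)
      then show ?thesis
        unfolding update_sum_def of_nat_sum ennreal_of_nat_eq_real_of_nat[symmetric] .
    qed
    have "ennreal (real (2 * n\<^sup>2)) = (\<integral>\<^sup>+us. ennreal (real (2 * n\<^sup>2)) \<partial>measure_pmf (workload U n))"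
      by simp
    also have "\<dots> \<le> (\<integral>\<^sup>+us. update_sum N n T us \<omega> \<rho> \<partial>measure_pmf (workload U n))"
      by (intro nn_integral_mono_AE AE_pmfI le)
    finally show "ennreal (real (2 * n\<^sup>2)) \<le> (\<integral>\<^sup>+us. update_sum N n T us \<omega> \<rho> \<partial>measure_pmf (workload U n))" .
  qed
  then have "ennreal (real (2 * n\<^sup>2)) / of_nat (2 * n\<^sup>2) \<le> expected_update_time U N n T"
    unfolding expected_update_time_eq by (rule divide_right_mono_ennreal)
  also have "ennreal (real (2 * n\<^sup>2)) / of_nat (2 * n\<^sup>2) = 1"
    using n unfolding ennreal_of_nat_eq_real_of_nat by (subst divide_ennreal) auto
  finally show ?thesis .
qed

text \<open>The query time is bounded only on average over the random bits. Hence the inequality for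
  fixed bits is integrated as a linear combination of update and query times, and the hypothesis is
  used afterwards. It makes the query term at most n^2 J / 8, so n^2 J / 4 <= 8 u; dividing by the 2
  n^2 operations gives J / 64.\<close>

lemma expected_update_time_ge:
  fixes Q :: real and h J :: nat
  assumes h: "1 \<le> h" and Q: "0 < Q" "1024 * Q \<le> 2 ^ h"
    and small: "\<And>j. j < J \<Longrightarrow> 64 * (2 ^ (h * 2 ^ j))\<^sup>2 \<le> n"
      "\<And>j. j < J \<Longrightarrow> 1024 * (2 ^ (h * 2 ^ j))\<^sup>2 * (real N - n) \<le> n"
    and query: "expected_query_time U N n T \<le> ennreal Q"
  shows "ennreal (J / 64) \<le> expected_update_time U N n T"
proof -
  have n: "0 < real n" using n_pos by simp
  define c where "c = J / (8 * Q)"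
  have c: "0 \<le> c" using Q by (simp add: c_def)
  define u where "u = (\<integral>\<^sup>+(\<omega>, \<rho>, us). update_sum N n T us \<omega> \<rho> \<partial>outcomes U n)"
  define q where "q = (\<integral>\<^sup>+(\<omega>, \<rho>, us). query_sum N n T us \<omega> \<rho> \<partial>outcomes U n)"
  note [measurable] = measurable_update_sum measurable_query_sum
  have "ennreal (3 / 8 * real (n\<^sup>2) * J)
      \<le> (\<integral>\<^sup>+(\<omega>, \<rho>, us). 8 * update_sum N n T us \<omega> \<rho> + ennreal c * query_sum N n T us \<omega> \<rho> \<partial>outcomes U n)"
  proof (rule const_le_nn_integral_outcomes)
    fix \<omega> \<rho>
    let ?u = "\<lambda>us. \<Sum>t = n..<n + 2 * n\<^sup>2. real (update_time N T \<omega> \<rho> us t)"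
    let ?q = "\<lambda>us. \<Sum>r = 1..n\<^sup>2. real (total_query_time \<omega> \<rho> us r)"
    have "3 / 8 * real (n\<^sup>2) * J \<le> 8 * E ?u + J * (E ?q / (8 * Q * n))"
      by (rule all_scales_bound[OF h Q small])
    also have "\<dots> = E (\<lambda>us. 8 * ?u us + c * (?q us / n))"
      by (simp add: c_def)
    finally have "ennreal (3 / 8 * real (n\<^sup>2) * J) \<le> ennreal (E (\<lambda>us. 8 * ?u us + c * (?q us / n)))"
      by (rule ennreal_leI)
    also have "\<dots> = (\<integral>\<^sup>+us. ennreal (8 * ?u us + c * (?q us / n)) \<partial>measure_pmf (workload U n))"
      using c by (intro nn_integral_eq_integral[symmetric] integrable_workload)
        (auto intro!: AE_I2 add_nonneg_nonneg mult_nonneg_nonneg divide_nonneg_nonneg sum_nonneg)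
    also have "\<dots> = (\<integral>\<^sup>+us. 8 * update_sum N n T us \<omega> \<rho> + ennreal c * query_sum N n T us \<omega> \<rho>
        \<partial>measure_pmf (workload U n))"
    proof (intro nn_integral_cong_AE AE_pmfI)
      fix us assume us: "us \<in> set_pmf (workload U n)"
      have u: "update_sum N n T us \<omega> \<rho> = ennreal (?u us)"
        by (simp add: update_sum_def ennreal_of_nat_eq_real_of_nat)
      have "ennreal (8 * ?u us + c * (?q us / n)) = ennreal (8 * ?u us) + ennreal (c * (?q us / n))"
        using c by (intro ennreal_plus mult_nonneg_nonneg divide_nonneg_nonneg sum_nonneg) auto
      also have "ennreal (8 * ?u us) = 8 * ennreal (?u us)"
        by (subst ennreal_mult') auto
      also have "ennreal (c * (?q us / n)) = ennreal c * ennreal (?q us / n)"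
        using c by (rule ennreal_mult')
      finally show "ennreal (8 * ?u us + c * (?q us / n))
          = 8 * update_sum N n T us \<omega> \<rho> + ennreal c * query_sum N n T us \<omega> \<rho>"
        unfolding query_sum_eq[OF us] u .
    qed
    finally show "ennreal (3 / 8 * real (n\<^sup>2) * J)
      \<le> (\<integral>\<^sup>+us. 8 * update_sum N n T us \<omega> \<rho> + ennreal c * query_sum N n T us \<omega> \<rho>
          \<partial>measure_pmf (workload U n))" .
  qed measurable
  also have "\<dots> = 8 * u + ennreal c * q"
  proof -
    note [measurable] = measurable_outcomes[OF measurable_update_sum, unfolded case_prod_beta]
      measurable_outcomes[OF measurable_query_sum, unfolded case_prod_beta]
    show ?thesis
      unfolding u_def q_def case_prod_beta
      by (subst nn_integral_add) (auto simp: nn_integral_cmult)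
  qed
  also have "ennreal c * q \<le> ennreal (real (n\<^sup>2) * J / 8)"
  proof -
    have "q / of_nat (n\<^sup>2) \<le> ennreal Q"
      using query unfolding expected_query_time_eq q_def .
    then have "of_nat (n\<^sup>2) * (q / of_nat (n\<^sup>2)) \<le> of_nat (n\<^sup>2) * ennreal Q"
      by (rule mult_left_mono) simp
    moreover have "of_nat (n\<^sup>2) * (q / of_nat (n\<^sup>2)) = q"
      unfolding ennreal_times_divide using n
      by (subst mult.commute, intro mult_divide_eq_ennreal) (auto simp: ennreal_of_nat_eq_real_of_nat)
    ultimately have "q \<le> ennreal Q * ennreal (real (n\<^sup>2))"
      by (simp only: ennreal_of_nat_eq_real_of_nat mult.commute)
    also have "\<dots> = ennreal (Q * real (n\<^sup>2))"
      using Q by (simp add: ennreal_mult)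
    finally have "ennreal c * q \<le> ennreal c * ennreal (Q * real (n\<^sup>2))"
      by (rule mult_left_mono) simp
    also have "\<dots> = ennreal (real (n\<^sup>2) * J / 8)"
      using c Q by (subst ennreal_mult[symmetric]) (auto simp: c_def)
    finally show ?thesis .
  qed
  finally have main: "ennreal (3 / 8 * real (n\<^sup>2) * J) \<le> 8 * u + ennreal (real (n\<^sup>2) * J / 8)"
    by simp
  have "ennreal (real (n\<^sup>2) * J / 32) \<le> u"
  \<comment> \<open>For infinite \<open>u\<close> the claim is trivial; otherwise the query term can
    be subtracted in the reals.\<close>
  proof (cases u)
    case (real z)
    then have "8 * u + ennreal (real (n\<^sup>2) * J / 8) = ennreal (8 * z + real (n\<^sup>2) * J / 8)"
      by (simp add: ennreal_plus ennreal_mult)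
    with main have "ennreal (3 / 8 * real (n\<^sup>2) * J) \<le> ennreal (8 * z + real (n\<^sup>2) * J / 8)"
      by (simp only:)
    then have "3 / 8 * real (n\<^sup>2) * J \<le> 8 * z + real (n\<^sup>2) * J / 8"
      using real by (subst (asm) ennreal_le_iff) auto
    then show ?thesis using real by (auto intro!: ennreal_leI simp: mult_ac)
  qed simp
  then have "ennreal (real (n\<^sup>2) * J / 32) / of_nat (2 * n\<^sup>2) \<le> u / of_nat (2 * n\<^sup>2)"
    by (rule divide_right_mono_ennreal)
  also have "ennreal (real (n\<^sup>2) * J / 32) / of_nat (2 * n\<^sup>2) = ennreal (J / 64)"
    using n unfolding ennreal_of_nat_eq_real_of_nat by (subst divide_ennreal) auto
  finally show ?thesis
    unfolding expected_update_time_eq u_def .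
qed

end

section \<open>Choice of the scales\<close>

text \<open>Shows that a query time above 2^sqrt(L) already exceeds the claimed bound. With s = sqrt
  L, log L = 2 log s <= 3 s <= (9/2) 2^s.\<close>

lemma log_two_le_two_powr_sqrt:
  assumes "0 < L"
  shows "log 2 L \<le> 5 * 2 powr sqrt L"
proof -
  define s where "s = sqrt L"
  have s: "0 < s" "L = s * s" using assms by (auto simp: s_def)
  note ln2 = ln2_ge_two_thirds
  have "log 2 s \<le> 3 / 2 * s"
  proof -
    have "ln s \<le> s" using ln_le_minus_one[OF s(1)] by simp
    also have "\<dots> \<le> 3 / 2 * s * ln 2"
      using mult_left_mono[OF ln2, of "3 / 2 * s"] s by simp
    finally show ?thesis using ln2 by (simp add: log_def divide_simps)
  qed
  moreover have "s \<le> 3 / 2 * 2 powr s"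
  proof -
    have "2 / 3 * s \<le> ln 2 * s" using s by (intro mult_right_mono ln2) simp
    also have "\<dots> \<le> 1 + s * ln 2" by simp
    also have "\<dots> \<le> 2 powr s" by (simp add: powr_def)
    finally show ?thesis by simp
  qed
  moreover have "log 2 L = 2 * log 2 s"
    unfolding s(2) using s(1) by (subst log_mult) auto
  moreover have "0 \<le> 2 powr s" by simp
  ultimately show ?thesis unfolding s_def[symmetric] by linarith
qed

text \<open>With s = sqrt L, 2^h must exceed the query time of order 2^s while R^2 stays below
  2^(L/2), that is \<epsilon> to the power -1/2. Taking h of order s leaves about log (L / h), hence
  about half of log L, scales.\<close>

lemma (in churned_table) update_time_bound_small_epsilon:
  fixes b C \<epsilon> :: real
  defines "L \<equiv> log 2 (1 / \<epsilon>)"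
  assumes \<epsilon>: "1 / real n \<le> \<epsilon>" "0 < \<epsilon>" and N: "real N \<le> (1 + b * \<epsilon>) * real n"
    and b: "0 < b" and C: "0 < C"
    and L: "65536 \<le> L" "2 * log 2 (1024 * b) \<le> L" "(log 2 (1024 * C))\<^sup>2 \<le> L"
    and query: "expected_query_time U N n T \<le> ennreal (C * 2 powr sqrt L)"
  shows "ennreal (1 / 256 * log 2 L) \<le> expected_update_time U N n T"
proof -
  define s where "s = sqrt L"
  have "sqrt (256\<^sup>2) \<le> s" unfolding s_def using L(1) by (intro real_sqrt_le_mono) simp
  then have s: "256 \<le> s" by simp
  have ss: "s * s = L" using L(1) by (simp add: s_def)
  have n: "0 < real n" using n_pos by simp
  have eL: "2 powr L = 1 / \<epsilon>" using \<epsilon> by (simp add: L_def)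
  have "1 \<le> \<epsilon> * real n" using \<epsilon>(1) n by (simp only: pos_divide_le_eq)
  then have "1 / \<epsilon> \<le> real n" using \<epsilon>(2) by (simp only: pos_divide_le_eq mult.commute)
  then have Ln: "2 powr L \<le> real n" unfolding eL .
  \<comment> \<open>One half of the exponent 2 s absorbs the constant 1024 C, the other half the
    query time.\<close>
  define h where "h = nat \<lceil>2 * s\<rceil>"
  have h: "2 * s \<le> real h" "real h \<le> 3 * s" "1 \<le> h"
    using s unfolding h_def by linarith+
  \<comment> \<open>For j < J this gives 2^j <= s / 12, so h 2^j <= 3 s * s / 12 = L / 4 and R^2 <=
    2^(L/2).\<close>
  define J where "J = nat \<lfloor>log 2 (s / 6)\<rfloor>"
  have "log 2 32 \<le> log 2 (s / 6)" using s by (subst log_le_cancel_iff) auto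
  moreover have "log 2 32 = (5::real)" using log_pow_cancel[of "2::real" 5] by simp
  ultimately have J: "real J \<le> log 2 (s / 6)" "log 2 (s / 6) - 1 \<le> real J"
    unfolding J_def by linarith+
  have small: "2 powr (2 * real (h * 2 ^ j)) \<le> 2 powr (L / 2)" if "j < J" for j
  proof -
    have "2 powr (real j + 1) \<le> 2 powr log 2 (s / 6)"
      using that J by (intro powr_mono) auto
    then have j: "2 * 2 ^ j \<le> s / 6"
      using s by (simp add: powr_add powr_realpow)
    have "real (h * 2 ^ j) \<le> (3 * s) * (s / 12)"
      using h j s by (simp only: of_nat_mult of_nat_power of_nat_numeral) (intro mult_mono, auto)
    then show ?thesis using ss by (intro powr_mono) auto
  qed
  have sq: "(2 ^ k)\<^sup>2 = 2 powr (2 * real k)" for k :: nat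
  proof -
    have "2 powr (2 * real k) = 2 powr real (2 * k)" by simp
    also have "\<dots> = 2 ^ (2 * k)" by (rule powr_realpow) simp
    also have "\<dots> = (2 ^ k)\<^sup>2" by (rule power_even_eq)
    finally show ?thesis by (rule sym)
  qed
  have half: "2 powr (L / 2) * 2 powr (L / 2) = 2 powr L"
    by (simp only: powr_add[symmetric] field_sum_of_halves)
  have "ennreal (real J / 64) \<le> expected_update_time U N n T"
  proof (rule expected_update_time_ge[OF h(3) _ _ _ _ query])
    show "0 < C * 2 powr sqrt L" using C by simp
    have "\<bar>log 2 (1024 * C)\<bar> \<le> s"
      using L(3) real_sqrt_le_mono[OF L(3)] by (simp add: s_def)
    then have "2 powr (log 2 (1024 * C)) \<le> 2 powr s" by (intro powr_mono) auto
    then have "1024 * C \<le> 2 powr s" using C by simp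
    then have "1024 * (C * 2 powr sqrt L) \<le> 2 powr s * 2 powr s"
      using s by (simp add: s_def[symmetric] mult_right_mono)
    also have "\<dots> = 2 powr (2 * s)" by (simp only: powr_add[symmetric] mult_2)
    also have "\<dots> \<le> 2 powr real h" using h by (intro powr_mono) auto
    finally show "1024 * (C * 2 powr sqrt L) \<le> 2 ^ h" by (simp add: powr_realpow)
  next
    fix j assume j: "j < J"
    have "real (64 * (2 ^ (h * 2 ^ j))\<^sup>2) = 64 * 2 powr (2 * real (h * 2 ^ j))"
      using sq[of "h * 2 ^ j"] by simp
    also have "\<dots> \<le> 64 * 2 powr (L / 2)" using small[OF j] by simp
    also have "(64::real) = 2 powr 6" by (simp add: powr_numeral)
    also have "2 powr 6 * 2 powr (L / 2) \<le> 2 powr (L / 2) * 2 powr (L / 2)"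
      using L(1) by (intro mult_right_mono powr_mono) auto
    also have "\<dots> \<le> real n" unfolding half by (rule Ln)
    finally show "64 * (2 ^ (h * 2 ^ j))\<^sup>2 \<le> n" unfolding of_nat_le_iff .
  next
    fix j assume j: "j < J"
    have Nn: "real N - n \<le> b * \<epsilon> * n" using N by (simp add: algebra_simps)
    have "2 powr (log 2 (1024 * b)) \<le> 2 powr (L / 2)" using L(2) by (intro powr_mono) auto
    then have "1024 * b \<le> 2 powr (L / 2)" using b by simp
    then have "1024 * b * 2 powr (L / 2) \<le> 1 / \<epsilon>"
      unfolding eL[symmetric] half[symmetric] by (intro mult_right_mono) auto
    then have *: "1024 * b * 2 powr (L / 2) * \<epsilon> \<le> 1" using \<epsilon>(2) by (simp only: pos_le_divide_eq)
    have "1024 * (2 ^ (h * 2 ^ j))\<^sup>2 * (real N - n) \<le> 1024 * (2 ^ (h * 2 ^ j))\<^sup>2 * (b * \<epsilon> * n)"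
      using Nn by (intro mult_left_mono) auto
    also have "\<dots> \<le> 1024 * 2 powr (L / 2) * (b * \<epsilon> * n)"
      using small[OF j] sq[of "h * 2 ^ j"] b \<epsilon> by (intro mult_right_mono mult_left_mono) auto
    also have "\<dots> = (1024 * b * 2 powr (L / 2) * \<epsilon>) * n" by simp
    also have "\<dots> \<le> 1 * real n" using * by (intro mult_right_mono) auto
    finally show "1024 * (2 ^ (h * 2 ^ j))\<^sup>2 * (real N - n) \<le> n" by simp
  qed
  \<comment> \<open>As log s >= 8, J >= log s - log 6 - 1 >= log s - 4 >= (log s) / 2 = (log L) /
    4.\<close>
  moreover have "1 / 256 * log 2 L \<le> real J / 64"
  proof -
    have "log 2 (s / 6) = log 2 s - log 2 6" using s by (simp add: log_divide)
    moreover have "log 2 L = 2 * log 2 s"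
      unfolding ss[symmetric] using s by (subst log_mult) auto
    moreover have "log 2 6 \<le> log 2 (8::real)" by simp
    moreover have "log 2 8 = (3::real)" using log_pow_cancel[of "2::real" 3] by simp
    moreover have "log 2 256 \<le> log 2 s" using s by simp
    moreover have "log 2 256 = (8::real)" using log_pow_cancel[of "2::real" 8] by simp
    ultimately show ?thesis using J(2) by linarith
  qed
  ultimately show ?thesis
    by (meson ennreal_leI order_trans)
qed

lemma update_time_bound:
  fixes b C \<epsilon>\<^sub>0 :: real
  assumes b: "0 < b" and \<epsilon>\<^sub>0: "\<epsilon>\<^sub>0 < 1" and C: "0 < C"
  shows "\<exists>c>0. \<forall>(n::nat) (U::nat) (N::nat) (\<epsilon>::real) (T::table).
    1 \<le> n \<and> n ^ 2 \<le> U \<and> 1 / real n \<le> \<epsilon> \<and> \<epsilon> \<le> \<epsilon>\<^sub>0 \<and> real N \<le> (1 + b * \<epsilon>) * real n \<and>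
    classical_table U N n T \<and>
    expected_query_time U N n T \<le> ennreal (C * 2 powr sqrt (log 2 (1 / \<epsilon>))) \<longrightarrow>
    ennreal (c * log 2 (log 2 (1 / \<epsilon>))) \<le> expected_update_time U N n T"
proof -
  define M where "M = max 65536 (max (2 * log 2 (1024 * b)) ((log 2 (1024 * C))\<^sup>2))"
  have M: "65536 \<le> M" by (simp add: M_def)
  \<comment> \<open>Small enough for both cases: c <= 1/256 serves L >= M, and c log M <= 1 lets the
    trivial bound 1 serve L < M.\<close>
  define c where "c = 1 / (256 + log 2 M)"
  have logM: "0 \<le> log 2 M" using M by simp
  have c: "0 < c" "c \<le> 1 / 256" "c * log 2 M \<le> 1"
    using logM by (auto simp: c_def divide_simps)
  show ?thesis
  proof (intro exI[of _ c] conjI c(1) allI impI, elim conjE)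
    fix n U N :: nat and \<epsilon> :: real and T :: table
    assume n: "1 \<le> n" and U: "n ^ 2 \<le> U" and \<epsilon>: "1 / real n \<le> \<epsilon>" "\<epsilon> \<le> \<epsilon>\<^sub>0"
      and N: "real N \<le> (1 + b * \<epsilon>) * real n" and T: "classical_table U N n T"
      and query: "expected_query_time U N n T \<le> ennreal (C * 2 powr sqrt (log 2 (1 / \<epsilon>)))"
    define L where "L = log 2 (1 / \<epsilon>)"
    \<comment> \<open>For n = 1 the lower bound on \<epsilon> would force \<epsilon> >= 1.\<close>
    have "n \<noteq> 1" using \<epsilon> \<epsilon>\<^sub>0 by auto
    then interpret churned_table U N n T
      using n U T by (intro churned_table.intro churned_table_axioms.intro) auto
    have "0 < 1 / real n" using n by simp
    then have \<epsilon>_pos: "0 < \<epsilon>" using \<epsilon>(1) by linarith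
    have L0: "0 < L" using \<epsilon>_pos \<epsilon> \<epsilon>\<^sub>0 by (simp add: L_def)
    show "ennreal (c * log 2 (log 2 (1 / \<epsilon>))) \<le> expected_update_time U N n T"
    proof (cases "M \<le> L")
      case True
      have "c * log 2 L \<le> 1 / 256 * log 2 L"
        using c True M by (intro mult_right_mono) auto
      then have "ennreal (c * log 2 L) \<le> ennreal (1 / 256 * log 2 L)" by (rule ennreal_leI)
      also have "\<dots> \<le> expected_update_time U N n T"
        unfolding L_def
        by (rule update_time_bound_small_epsilon[OF \<epsilon>(1) \<epsilon>_pos N b C _ _ _ query])
           (use True in \<open>auto simp: M_def L_def\<close>)
      finally show ?thesis unfolding L_def .
    next
      case False
      have "log 2 L \<le> log 2 M" using False L0 by simp
      then have "c * log 2 L \<le> c * log 2 M" using c by (intro mult_left_mono) auto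
      then have "ennreal (c * log 2 L) \<le> ennreal 1" using c by (intro ennreal_leI) linarith
      also have "\<dots> \<le> expected_update_time U N n T" using expected_update_time_ge_one by simp
      finally show ?thesis unfolding L_def .
    qed
  qed
qed

theorem theorem3:
  "\<exists>k\<^sub>0::nat. \<forall>(k\<^sub>1::nat) (a::real) (b::real) (\<epsilon>\<^sub>0::real).
     k\<^sub>0 \<le> k\<^sub>1 \<and> 0 < a \<and> a \<le> b \<and> 0 < \<epsilon>\<^sub>0 \<and> \<epsilon>\<^sub>0 < 1 \<longrightarrow>
     (\<exists>c>0::real. \<forall>(n::nat) (U::nat) (N::nat) (\<epsilon>::real) (T::table).
        1 \<le> n \<and> n ^ k\<^sub>0 \<le> U \<and> U \<le> n ^ k\<^sub>1 \<and> 1 / real n \<le> \<epsilon> \<and> \<epsilon> \<le> \<epsilon>\<^sub>0 \<and>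
        load_factor a b \<epsilon> N n \<and> classical_table U N n T \<longrightarrow>
        ennreal (c * log 2 (log 2 (1 / \<epsilon>))) \<le> expected_operation_time U N n T) \<and>
     (\<forall>C>0::real. \<exists>c>0::real. \<forall>(n::nat) (U::nat) (N::nat) (\<epsilon>::real) (T::table).
        1 \<le> n \<and> n ^ k\<^sub>0 \<le> U \<and> U \<le> n ^ k\<^sub>1 \<and> 1 / real n \<le> \<epsilon> \<and> \<epsilon> \<le> \<epsilon>\<^sub>0 \<and>
        load_factor a b \<epsilon> N n \<and> classical_table U N n T \<and>
        expected_query_time U N n T \<le> ennreal (C * 2 powr sqrt (log 2 (1 / \<epsilon>))) \<longrightarrow>
        ennreal (c * log 2 (log 2 (1 / \<epsilon>))) \<le> expected_update_time U N n T)"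
proof (intro exI[of _ 2] allI impI, elim conjE, intro conjI allI impI)
  fix k\<^sub>1 :: nat and a b \<epsilon>\<^sub>0 :: real
  assume "0 < a" "a \<le> b" and \<epsilon>\<^sub>0: "\<epsilon>\<^sub>0 < 1"
  then have b: "0 < b" by simp
  \<comment> \<open>The threshold C = 1 splits the tables: if the query time is at most 2^sqrt(L)
    the update bound applies, and otherwise the query time alone is large enough.\<close>
  from update_time_bound[OF b \<epsilon>\<^sub>0, of 1] obtain c :: real where c: "0 < c"
    and bound: "\<And>n U N \<epsilon> T. 1 \<le> n \<Longrightarrow> n ^ 2 \<le> U \<Longrightarrow> 1 / real n \<le> \<epsilon> \<Longrightarrow> \<epsilon> \<le> \<epsilon>\<^sub>0 \<Longrightarrow>
      real N \<le> (1 + b * \<epsilon>) * real n \<Longrightarrow> classical_table U N n T \<Longrightarrow>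
      expected_query_time U N n T \<le> ennreal (1 * 2 powr sqrt (log 2 (1 / \<epsilon>))) \<Longrightarrow>
      ennreal (c * log 2 (log 2 (1 / \<epsilon>))) \<le> expected_update_time U N n T"
    by auto
  define c' where "c' = min c (1 / 5)"
  have c': "0 < c'" "c' \<le> c" "c' \<le> 1 / 5" using c by (auto simp: c'_def)
  show "\<exists>c>0::real. \<forall>(n::nat) (U::nat) (N::nat) (\<epsilon>::real) (T::table).
        1 \<le> n \<and> n ^ 2 \<le> U \<and> U \<le> n ^ k\<^sub>1 \<and> 1 / real n \<le> \<epsilon> \<and> \<epsilon> \<le> \<epsilon>\<^sub>0 \<and>
        load_factor a b \<epsilon> N n \<and> classical_table U N n T \<longrightarrow>
        ennreal (c * log 2 (log 2 (1 / \<epsilon>))) \<le> expected_operation_time U N n T"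
  proof (intro exI[of _ c'] conjI c'(1) allI impI, elim conjE)
    fix n U N :: nat and \<epsilon> :: real and T :: table
    assume n: "1 \<le> n" and U: "n ^ 2 \<le> U" and \<epsilon>: "1 / real n \<le> \<epsilon>" "\<epsilon> \<le> \<epsilon>\<^sub>0"
      and N: "load_factor a b \<epsilon> N n" and T: "classical_table U N n T"
    define L where "L = log 2 (1 / \<epsilon>)"
    have "0 < 1 / real n" using n by simp
    then have "0 < \<epsilon>" using \<epsilon>(1) by linarith
    then have L0: "0 < L" using \<epsilon> \<epsilon>\<^sub>0 by (simp add: L_def)
    have "ennreal (c' * log 2 L) \<le> expected_operation_time U N n T"
    \<comment> \<open>If \<epsilon> >= 1/2 the bound is not positive and \<open>ennreal\<close> maps
      it to 0.\<close>
    proof (cases "log 2 L \<le> 0")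
      case True
      then have "c' * log 2 L \<le> 0" using c' by (simp add: mult_nonneg_nonpos)
      then show ?thesis by (simp add: ennreal_neg)
    next
      case logL: False
      show ?thesis
      proof (cases "expected_query_time U N n T \<le> ennreal (1 * 2 powr sqrt L)")
        case True
        have "ennreal (c' * log 2 L) \<le> ennreal (c * log 2 L)"
          using c' logL by (intro ennreal_leI mult_right_mono) auto
        also have "\<dots> \<le> expected_update_time U N n T"
          unfolding L_def
          by (rule bound[OF n U \<epsilon> _ T]) (use N True in \<open>auto simp: load_factor_def L_def\<close>)
        finally show ?thesis
          by (simp add: expected_operation_time_def max.coboundedI1)
      next
        case False
        have "c' * log 2 L \<le> 1 / 5 * log 2 L"
          using c' logL by (intro mult_right_mono) auto
        also have "\<dots> \<le> 1 * 2 powr sqrt L"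
          using log_two_le_two_powr_sqrt[OF L0] by simp
        finally have "ennreal (c' * log 2 L) \<le> ennreal (1 * 2 powr sqrt L)"
          by (rule ennreal_leI)
        also have "\<dots> \<le> expected_query_time U N n T" using False by simp
        finally show ?thesis
          by (simp add: expected_operation_time_def max.coboundedI2)
      qed
    qed
    then show "ennreal (c' * log 2 (log 2 (1 / \<epsilon>))) \<le> expected_operation_time U N n T"
      unfolding L_def .
  qed
next
  fix k\<^sub>1 :: nat and a b \<epsilon>\<^sub>0 C :: real
  assume "0 < a" "a \<le> b" and \<epsilon>\<^sub>0: "\<epsilon>\<^sub>0 < 1" and C: "0 < C"
  then have b: "0 < b" by simp
  from update_time_bound[OF b \<epsilon>\<^sub>0 C]
  show "\<exists>c>0::real. \<forall>(n::nat) (U::nat) (N::nat) (\<epsilon>::real) (T::table).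
        1 \<le> n \<and> n ^ 2 \<le> U \<and> U \<le> n ^ k\<^sub>1 \<and> 1 / real n \<le> \<epsilon> \<and> \<epsilon> \<le> \<epsilon>\<^sub>0 \<and>
        load_factor a b \<epsilon> N n \<and> classical_table U N n T \<and>
        expected_query_time U N n T \<le> ennreal (C * 2 powr sqrt (log 2 (1 / \<epsilon>))) \<longrightarrow>
        ennreal (c * log 2 (log 2 (1 / \<epsilon>))) \<le> expected_update_time U N n T"
    unfolding load_factor_def by blast
qed

end
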